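(* If $(g,\xi,\lambda)$ is a Ricci soliton on an anti-invariant submanifold $M$ of an SQ-Sasakian manifold $M^*$, with structure $(\phi,\xi,\eta,g)$, such that $\xi$ is tangent to $M$, then $M$ is Einstein.
   Context: An almost contact metric manifold $(\phi,\xi,\eta,g)$ is a smooth manifold with a $(1,1)$-tensor $\phi$, a vector field $\xi$, a $1$-form $\eta$ and a Riemannian metric $g$ such that $\phi^2X=-X+\eta(X)\xi$, $\phi\xi=0$, $\eta(\xi)=1$, $g(X,\xi)=\eta(X)$, $\eta(\phi X)=0$, $g(\phi X,\phi Y)=g(X,Y)-\eta(X)\eta(Y)$, $g(\phi X,Y)=-g(X,\phi Y)$. Its fundamental $2$-form is $\Phi(X,Y)=g(X,\phi Y)$. It is normal if $[\phi X,\phi Y]+\phi^2[X,Y]-\phi[\phi X,Y]-\phi[X,\phi Y]+2d\eta(X,Y)\xi=0$. An SQ-Sasakian manifold $M^*$ (of dimension $2n+1>3$) is a normal almost contact metric manifold with $d\Phi=0$ and $\bar\nabla_X\xi=-\beta\phi X$ for a smooth function $\beta$ with $\xi\beta=0$, where $\bar\nabla$ is the Levi-Civita connection. $M$ is a submanifold of dimension $2m+1$, $m<n$, with induced metric $g$. It is anti-invariant if $\phi X$ is normal to $M$ for every $X$ tangent to $M$, i.e. $\phi(TM)\subset T^\perp M$ at every point of $M$. A Ricci soliton $(g,\xi,\lambda)$ on $M$ means that $\lambda$ is a real number and $(\pounds_\xi g)(Y,Z)+2S(Y,Z)+2\lambda g(Y,Z)=0$ for all $Y,Z$ tangent to $M$,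 where $S$ is the Ricci tensor of $(M,g)$ and $\pounds_\xi$ is the Lie derivative. Einstein means $S=c\,g$ for a constant $c$. *)

theory Defs
  imports "HOL-Analysis.Analysis" "HOL-Library.Function_Algebras"
begin

section \<open>Smooth maps between Euclidean spaces\<close>

text \<open>Only meaningful for open \<open>S\<close>: derivatives are taken with respect to full neighbourhoods.\<close>

primrec Ck_on :: "nat \<Rightarrow> 'e::euclidean_space set \<Rightarrow> ('e \<Rightarrow> 'v::real_normed_vector) \<Rightarrow> bool" where
  "Ck_on 0 S f \<longleftrightarrow> continuous_on S f"
| "Ck_on (Suc k) S f \<longleftrightarrow>
     (\<forall>x\<in>S. f differentiable at x) \<and> (\<forall>v. Ck_on k S (\<lambda>x. frechet_derivative f (at x) v))"

definition smooth_on :: "'e::euclidean_space set \<Rightarrow> ('e \<Rightarrow> 'v::real_normed_vector) \<Rightarrow> bool" where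
  "smooth_on S f \<longleftrightarrow> (\<forall>k. Ck_on k S f)"

section \<open>Smooth manifolds\<close>

text \<open>A chart is a pair of its domain and its coordinate map; only the values of the
  coordinate map on the domain matter. The dimension of a manifold modelled on \<open>'e\<close> is \<open>DIM('e)\<close>.\<close>

type_synonym ('a, 'e) chart = "'a set \<times> ('a \<Rightarrow> 'e)"

record ('a, 'e) manifold =
  mtop :: "'a topology"
  atlas :: "('a, 'e) chart set"

abbreviation points :: "('a, 'e) manifold \<Rightarrow> 'a set" where
  "points M \<equiv> topspace (mtop M)"

definition chart_inv :: "('a, 'e) chart \<Rightarrow> 'e \<Rightarrow> 'a" where
  "chart_inv c = inv_into (fst c) (snd c)"

definition smooth_manifold :: "('a, 'e::euclidean_space) manifold \<Rightarrow> bool" where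
  "smooth_manifold M \<longleftrightarrow>
     Hausdorff_space (mtop M) \<and> second_countable (mtop M) \<and>
     (\<Union>c\<in>atlas M. fst c) = points M \<and>
     (\<forall>c\<in>atlas M. openin (mtop M) (fst c) \<and> open (snd c ` fst c) \<and>
        homeomorphic_map (subtopology (mtop M) (fst c)) (top_of_set (snd c ` fst c)) (snd c)) \<and>
     (\<forall>c\<in>atlas M. \<forall>d\<in>atlas M. smooth_on (snd c ` (fst c \<inter> fst d)) (snd d \<circ> chart_inv c))"

definition charts_at :: "('a, 'e) manifold \<Rightarrow> 'a \<Rightarrow> ('a, 'e) chart set" where
  "charts_at M p = {c \<in> atlas M. p \<in> fst c}"

definition smooth_fun :: "('a, 'e::euclidean_space) manifold \<Rightarrow> 'a set \<Rightarrow> ('a \<Rightarrow> real) \<Rightarrow> bool" where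
  "smooth_fun M U f \<longleftrightarrow>
     (\<forall>c\<in>atlas M. smooth_on (snd c ` (U \<inter> fst c)) (f \<circ> chart_inv c))"

definition smooth_map ::
  "('a, 'e::euclidean_space) manifold \<Rightarrow> ('b, 'f::euclidean_space) manifold \<Rightarrow> ('a \<Rightarrow> 'b) \<Rightarrow> bool" where
  "smooth_map M N f \<longleftrightarrow> continuous_map (mtop M) (mtop N) f \<and>
     (\<forall>c\<in>atlas M. \<forall>d\<in>atlas N.
        smooth_on (snd c ` (fst c \<inter> f -` fst d)) (snd d \<circ> f \<circ> chart_inv c))"

section \<open>Tangent vectors and vector fields\<close>

text \<open>A tangent vector at \<open>p\<close> is the family of its coordinate vectors in all charts around \<open>p\<close>,
  transforming under a change of charts by the derivative of the transition map; as a function of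
  the chart it is set to \<open>0\<close> on everything that is not a chart around \<open>p\<close>. Addition, subtraction
  and \<open>0\<close> are the pointwise ones of \<^theory>\<open>HOL-Library.Function_Algebras\<close>.\<close>

type_synonym ('a, 'e) tvec = "('a, 'e) chart \<Rightarrow> 'e"
type_synonym ('a, 'e) vfield = "'a \<Rightarrow> ('a, 'e) tvec"

definition tscale :: "real \<Rightarrow> ('a, 'e::real_vector) tvec \<Rightarrow> ('a, 'e) tvec"  (infixr \<open>*\<^sub>T\<close> 75) where
  "r *\<^sub>T v = (\<lambda>c. r *\<^sub>R v c)"

definition tangent_space :: "('a, 'e::euclidean_space) manifold \<Rightarrow> 'a \<Rightarrow> ('a, 'e) tvec set" where
  "tangent_space M p = {v.
     (\<forall>c. c \<notin> charts_at M p \<longrightarrow> v c = 0) \<and>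
     (\<forall>c\<in>charts_at M p. \<forall>d\<in>charts_at M p.
        v d = frechet_derivative (snd d \<circ> chart_inv c) (at (snd c p)) (v c))}"

definition chart_at :: "('a, 'e) manifold \<Rightarrow> 'a \<Rightarrow> ('a, 'e) chart" where
  "chart_at M p = (SOME c. c \<in> charts_at M p)"

text \<open>The differential of a map and the derivative of a function along a tangent vector do not
  depend on the chart used to compute them.\<close>

definition differential ::
  "('a, 'e::euclidean_space) manifold \<Rightarrow> ('b, 'f::euclidean_space) manifold \<Rightarrow> ('a \<Rightarrow> 'b) \<Rightarrow>
     'a \<Rightarrow> ('a, 'e) tvec \<Rightarrow> ('b, 'f) tvec" where
  "differential M N f p v = (let c = chart_at M p in
     (\<lambda>d. if d \<in> charts_at N (f p)
          then frechet_derivative (snd d \<circ> f \<circ> chart_inv c) (at (snd c p)) (v c) else 0))"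

definition vderiv :: "('a, 'e::euclidean_space) manifold \<Rightarrow> ('a, 'e) vfield \<Rightarrow> ('a \<Rightarrow> real) \<Rightarrow> 'a \<Rightarrow> real" where
  "vderiv M X f p = (let c = chart_at M p in
     frechet_derivative (f \<circ> chart_inv c) (at (snd c p)) (X p c))"

text \<open>For open \<open>U\<close> this makes \<open>X\<close> a vector field on \<open>U\<close>; its values outside \<open>U\<close> are irrelevant.\<close>

definition smooth_vfield :: "('a, 'e::euclidean_space) manifold \<Rightarrow> 'a set \<Rightarrow> ('a, 'e) vfield \<Rightarrow> bool" where
  "smooth_vfield M U X \<longleftrightarrow>
     (\<forall>p\<in>U. X p \<in> tangent_space M p) \<and>
     (\<forall>c\<in>atlas M. smooth_on (snd c ` (U \<inter> fst c)) (\<lambda>x. X (chart_inv c x) c))"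

text \<open>\<open>[X, Y]\<^sup>k = X\<^sup>i \<partial>\<^sub>i Y\<^sup>k - Y\<^sup>i \<partial>\<^sub>i X\<^sup>k\<close> in every chart.\<close>

definition lie_bracket ::
  "('a, 'e::euclidean_space) manifold \<Rightarrow> ('a, 'e) vfield \<Rightarrow> ('a, 'e) vfield \<Rightarrow> ('a, 'e) vfield" where
  "lie_bracket M X Y p = (\<lambda>c. if c \<in> charts_at M p
     then frechet_derivative (\<lambda>x. Y (chart_inv c x) c) (at (snd c p)) (X p c)
        - frechet_derivative (\<lambda>x. X (chart_inv c x) c) (at (snd c p)) (Y p c)
     else 0)"

text \<open>The field that is constantly \<open>b\<close> in the chart \<open>c\<close>.\<close>

definition coord_field ::
  "('a, 'e::euclidean_space) manifold \<Rightarrow> ('a, 'e) chart \<Rightarrow> 'e \<Rightarrow> ('a, 'e) vfield" where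
  "coord_field M c b p = (\<lambda>d. if c \<in> charts_at M p \<and> d \<in> charts_at M p
     then frechet_derivative (snd d \<circ> chart_inv c) (at (snd c p)) b else 0)"

section \<open>Tensor fields\<close>

type_synonym ('a, 'e) endofield = "'a \<Rightarrow> ('a, 'e) tvec \<Rightarrow> ('a, 'e) tvec"
type_synonym ('a, 'e) oneform = "'a \<Rightarrow> ('a, 'e) tvec \<Rightarrow> real"
type_synonym ('a, 'e) twotensor = "'a \<Rightarrow> ('a, 'e) tvec \<Rightarrow> ('a, 'e) tvec \<Rightarrow> real"

definition tensor_1_1 :: "('a, 'e::euclidean_space) manifold \<Rightarrow> ('a, 'e) endofield \<Rightarrow> bool" where
  "tensor_1_1 M A \<longleftrightarrow>
     (\<forall>p\<in>points M. \<forall>u\<in>tangent_space M p. A p u \<in> tangent_space M p \<and>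
        (\<forall>v\<in>tangent_space M p. A p (u + v) = A p u + A p v) \<and>
        (\<forall>r. A p (r *\<^sub>T u) = r *\<^sub>T A p u)) \<and>
     (\<forall>U X. openin (mtop M) U \<and> smooth_vfield M U X \<longrightarrow> smooth_vfield M U (\<lambda>p. A p (X p)))"

definition one_form :: "('a, 'e::euclidean_space) manifold \<Rightarrow> ('a, 'e) oneform \<Rightarrow> bool" where
  "one_form M \<omega> \<longleftrightarrow>
     (\<forall>p\<in>points M. \<forall>u\<in>tangent_space M p.
        (\<forall>v\<in>tangent_space M p. \<omega> p (u + v) = \<omega> p u + \<omega> p v) \<and>
        (\<forall>r. \<omega> p (r *\<^sub>T u) = r * \<omega> p u)) \<and>
     (\<forall>U X. openin (mtop M) U \<and> smooth_vfield M U X \<longrightarrow> smooth_fun M U (\<lambda>p. \<omega> p (X p)))"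

definition riemannian_metric :: "('a, 'e::euclidean_space) manifold \<Rightarrow> ('a, 'e) twotensor \<Rightarrow> bool" where
  "riemannian_metric M g \<longleftrightarrow>
     (\<forall>p\<in>points M. \<forall>u\<in>tangent_space M p.
        (\<forall>v\<in>tangent_space M p. g p u v = g p v u \<and>
           (\<forall>w\<in>tangent_space M p. g p (u + v) w = g p u w + g p v w) \<and>
           (\<forall>r. g p (r *\<^sub>T u) v = r * g p u v)) \<and>
        (u \<noteq> 0 \<longrightarrow> 0 < g p u u)) \<and>
     (\<forall>U X Y. openin (mtop M) U \<and> smooth_vfield M U X \<and> smooth_vfield M U Y \<longrightarrow>
        smooth_fun M U (\<lambda>p. g p (X p) (Y p)))"

text \<open>Exterior derivatives are normalised as in contact geometry (Blair), with the factor \<open>1/(k+1)\<close>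
  for a \<open>k\<close>-form: \<open>2 d\<eta>(X,Y) = X \<eta>(Y) - Y \<eta>(X) - \<eta>([X,Y])\<close>.\<close>

definition ext_deriv1 ::
  "('a, 'e::euclidean_space) manifold \<Rightarrow> ('a, 'e) oneform \<Rightarrow>
     ('a, 'e) vfield \<Rightarrow> ('a, 'e) vfield \<Rightarrow> 'a \<Rightarrow> real" where
  "ext_deriv1 M \<omega> X Y p = (1/2) *
     (vderiv M X (\<lambda>q. \<omega> q (Y q)) p - vderiv M Y (\<lambda>q. \<omega> q (X q)) p - \<omega> p (lie_bracket M X Y p))"

definition ext_deriv2 ::
  "('a, 'e::euclidean_space) manifold \<Rightarrow> ('a, 'e) twotensor \<Rightarrow>
     ('a, 'e) vfield \<Rightarrow> ('a, 'e) vfield \<Rightarrow> ('a, 'e) vfield \<Rightarrow> 'a \<Rightarrow> real" where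
  "ext_deriv2 M \<Omega> X Y Z p = (1/3) *
     (vderiv M X (\<lambda>q. \<Omega> q (Y q) (Z q)) p
    + vderiv M Y (\<lambda>q. \<Omega> q (Z q) (X q)) p
    + vderiv M Z (\<lambda>q. \<Omega> q (X q) (Y q)) p
    - \<Omega> p (lie_bracket M X Y p) (Z p)
    - \<Omega> p (lie_bracket M Y Z p) (X p)
    - \<Omega> p (lie_bracket M Z X p) (Y p))"

definition lie_deriv2 ::
  "('a, 'e::euclidean_space) manifold \<Rightarrow> ('a, 'e) vfield \<Rightarrow> ('a, 'e) twotensor \<Rightarrow>
     ('a, 'e) vfield \<Rightarrow> ('a, 'e) vfield \<Rightarrow> 'a \<Rightarrow> real" where
  "lie_deriv2 M V t Y Z p =
     vderiv M V (\<lambda>q. t q (Y q) (Z q)) p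
     - t p (lie_bracket M V Y p) (Z p) - t p (Y p) (lie_bracket M V Z p)"

section \<open>Levi-Civita connection and Ricci tensor\<close>

text \<open>An affine connection acts on vector fields defined on open subsets of \<open>M\<close>: whenever \<open>X\<close>
  and \<open>Y\<close> are smooth on \<open>U\<close>, \<open>D X Y\<close> is the field \<open>\<nabla>\<^sub>X Y\<close> on \<open>U\<close>.\<close>

type_synonym ('a, 'e) connection = "('a, 'e) vfield \<Rightarrow> ('a, 'e) vfield \<Rightarrow> ('a, 'e) vfield"

definition affine_connection :: "('a, 'e::euclidean_space) manifold \<Rightarrow> ('a, 'e) connection \<Rightarrow> bool" where
  "affine_connection M D \<longleftrightarrow>
     (\<forall>U X Y. openin (mtop M) U \<and> smooth_vfield M U X \<and> smooth_vfield M U Y \<longrightarrow>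
        smooth_vfield M U (D X Y) \<and>
        (\<forall>X'. smooth_vfield M U X' \<longrightarrow>
           (\<forall>p\<in>U. D (\<lambda>q. X q + X' q) Y p = D X Y p + D X' Y p)) \<and>
        (\<forall>Y'. smooth_vfield M U Y' \<longrightarrow>
           (\<forall>p\<in>U. D X (\<lambda>q. Y q + Y' q) p = D X Y p + D X Y' p)) \<and>
        (\<forall>f. smooth_fun M U f \<longrightarrow>
           (\<forall>p\<in>U. D (\<lambda>q. f q *\<^sub>T X q) Y p = f p *\<^sub>T D X Y p \<and>
                  D X (\<lambda>q. f q *\<^sub>T Y q) p = vderiv M X f p *\<^sub>T Y p + f p *\<^sub>T D X Y p)))"

definition levi_civita ::
  "('a, 'e::euclidean_space) manifold \<Rightarrow> ('a, 'e) twotensor \<Rightarrow> ('a, 'e) connection \<Rightarrow> bool" where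
  "levi_civita M g D \<longleftrightarrow> affine_connection M D \<and>
     (\<forall>U X Y Z. openin (mtop M) U \<and> smooth_vfield M U X \<and> smooth_vfield M U Y \<and> smooth_vfield M U Z \<longrightarrow>
        (\<forall>p\<in>U. D X Y p - D Y X p = lie_bracket M X Y p \<and>
               vderiv M X (\<lambda>q. g q (Y q) (Z q)) p = g p (D X Y p) (Z p) + g p (Y p) (D X Z p)))"

definition curvature ::
  "('a, 'e::euclidean_space) manifold \<Rightarrow> ('a, 'e) connection \<Rightarrow>
     ('a, 'e) vfield \<Rightarrow> ('a, 'e) vfield \<Rightarrow> ('a, 'e) vfield \<Rightarrow> ('a, 'e) vfield" where
  "curvature M D X Y Z p = D X (D Y Z) p - D Y (D X Z) p - D (lie_bracket M X Y) Z p"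

text \<open>\<open>S(Y,Z)\<close> is the trace of \<open>X \<mapsto> R(X,Y)Z\<close>, computed in the coordinate basis of a chart.\<close>

definition ricci ::
  "('a, 'e::euclidean_space) manifold \<Rightarrow> ('a, 'e) connection \<Rightarrow>
     ('a, 'e) vfield \<Rightarrow> ('a, 'e) vfield \<Rightarrow> 'a \<Rightarrow> real" where
  "ricci M D Y Z p = (let c = chart_at M p in
     \<Sum>b\<in>Basis. curvature M D (coord_field M c b) Y Z p c \<bullet> b)"

definition ricci_soliton ::
  "('a, 'e::euclidean_space) manifold \<Rightarrow> ('a, 'e) twotensor \<Rightarrow> ('a, 'e) connection \<Rightarrow>
     ('a, 'e) vfield \<Rightarrow> real \<Rightarrow> bool" where
  "ricci_soliton M g D V lam \<longleftrightarrow>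
     (\<forall>U Y Z. openin (mtop M) U \<and> smooth_vfield M U Y \<and> smooth_vfield M U Z \<longrightarrow>
        (\<forall>p\<in>U. lie_deriv2 M V g Y Z p + 2 * ricci M D Y Z p + 2 * lam * g p (Y p) (Z p) = 0))"

definition einstein ::
  "('a, 'e::euclidean_space) manifold \<Rightarrow> ('a, 'e) twotensor \<Rightarrow> ('a, 'e) connection \<Rightarrow> bool" where
  "einstein M g D \<longleftrightarrow> (\<exists>c::real.
     \<forall>U Y Z. openin (mtop M) U \<and> smooth_vfield M U Y \<and> smooth_vfield M U Z \<longrightarrow>
        (\<forall>p\<in>U. ricci M D Y Z p = c * g p (Y p) (Z p)))"

section \<open>SQ-Sasakian manifolds\<close>

definition almost_contact_metric ::
  "('a, 'e::euclidean_space) manifold \<Rightarrow> ('a, 'e) endofield \<Rightarrow> ('a, 'e) vfield \<Rightarrow>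
     ('a, 'e) oneform \<Rightarrow> ('a, 'e) twotensor \<Rightarrow> bool" where
  "almost_contact_metric M \<phi> \<xi> \<eta> g \<longleftrightarrow>
     smooth_manifold M \<and> tensor_1_1 M \<phi> \<and> smooth_vfield M (points M) \<xi> \<and>
     one_form M \<eta> \<and> riemannian_metric M g \<and>
     (\<forall>p\<in>points M. \<phi> p (\<xi> p) = 0 \<and> \<eta> p (\<xi> p) = 1 \<and>
        (\<forall>X\<in>tangent_space M p.
           \<phi> p (\<phi> p X) = - X + \<eta> p X *\<^sub>T \<xi> p \<and> g p X (\<xi> p) = \<eta> p X \<and> \<eta> p (\<phi> p X) = 0 \<and>
           (\<forall>Y\<in>tangent_space M p.
              g p (\<phi> p X) (\<phi> p Y) = g p X Y - \<eta> p X * \<eta> p Y \<and>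
              g p (\<phi> p X) Y = - g p X (\<phi> p Y))))"

definition fundamental_form ::
  "('a, 'e) endofield \<Rightarrow> ('a, 'e) twotensor \<Rightarrow> ('a, 'e) twotensor" where
  "fundamental_form \<phi> g p u v = g p u (\<phi> p v)"

definition normal_structure ::
  "('a, 'e::euclidean_space) manifold \<Rightarrow> ('a, 'e) endofield \<Rightarrow> ('a, 'e) vfield \<Rightarrow>
     ('a, 'e) oneform \<Rightarrow> bool" where
  "normal_structure M \<phi> \<xi> \<eta> \<longleftrightarrow>
     (\<forall>U X Y. openin (mtop M) U \<and> smooth_vfield M U X \<and> smooth_vfield M U Y \<longrightarrow>
        (\<forall>p\<in>U. lie_bracket M (\<lambda>q. \<phi> q (X q)) (\<lambda>q. \<phi> q (Y q)) p
             + \<phi> p (\<phi> p (lie_bracket M X Y p))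
             - \<phi> p (lie_bracket M (\<lambda>q. \<phi> q (X q)) Y p)
             - \<phi> p (lie_bracket M X (\<lambda>q. \<phi> q (Y q)) p)
             + (2 * ext_deriv1 M \<eta> X Y p) *\<^sub>T \<xi> p = 0))"

text \<open>On smooth fields the Levi-Civita connection is unique, so the existential quantifier
  over \<open>D\<close> only names it.\<close>

definition sq_sasakian ::
  "('a, 'e::euclidean_space) manifold \<Rightarrow> ('a, 'e) endofield \<Rightarrow> ('a, 'e) vfield \<Rightarrow>
     ('a, 'e) oneform \<Rightarrow> ('a, 'e) twotensor \<Rightarrow> bool" where
  "sq_sasakian M \<phi> \<xi> \<eta> g \<longleftrightarrow>
     DIM('e) > 3 \<and> odd DIM('e) \<and>
     almost_contact_metric M \<phi> \<xi> \<eta> g \<and> normal_structure M \<phi> \<xi> \<eta> \<and>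
     (\<forall>U X Y Z. openin (mtop M) U \<and> smooth_vfield M U X \<and> smooth_vfield M U Y \<and> smooth_vfield M U Z \<longrightarrow>
        (\<forall>p\<in>U. ext_deriv2 M (fundamental_form \<phi> g) X Y Z p = 0)) \<and>
     (\<exists>D \<beta>. levi_civita M g D \<and> smooth_fun M (points M) \<beta> \<and>
        (\<forall>p\<in>points M. vderiv M \<xi> \<beta> p = 0) \<and>
        (\<forall>U X. openin (mtop M) U \<and> smooth_vfield M U X \<longrightarrow>
           (\<forall>p\<in>U. D X \<xi> p = (- \<beta> p) *\<^sub>T \<phi> p (X p))))"

section \<open>Submanifolds\<close>

text \<open>An (immersed) submanifold: a manifold on a subset of the points of \<open>N\<close> whose inclusion is a
  smooth immersion. Its topology need not be the subspace topology.\<close>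

abbreviation incl_diff ::
  "('a, 'f::euclidean_space) manifold \<Rightarrow> ('a, 'e::euclidean_space) manifold \<Rightarrow>
     'a \<Rightarrow> ('a, 'f) tvec \<Rightarrow> ('a, 'e) tvec" where
  "incl_diff M N \<equiv> differential M N (\<lambda>p. p)"

definition submanifold ::
  "('a, 'f::euclidean_space) manifold \<Rightarrow> ('a, 'e::euclidean_space) manifold \<Rightarrow> bool" where
  "submanifold M N \<longleftrightarrow> smooth_manifold M \<and> smooth_manifold N \<and> points M \<subseteq> points N \<and>
     smooth_map M N (\<lambda>p. p) \<and> (\<forall>p\<in>points M. inj_on (incl_diff M N p) (tangent_space M p))"

definition induced_metric ::
  "('a, 'f::euclidean_space) manifold \<Rightarrow> ('a, 'e::euclidean_space) manifold \<Rightarrow>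
     ('a, 'e) twotensor \<Rightarrow> ('a, 'f) twotensor" where
  "induced_metric M N g p u v = g p (incl_diff M N p u) (incl_diff M N p v)"

definition tangent_to ::
  "('a, 'f::euclidean_space) manifold \<Rightarrow> ('a, 'e::euclidean_space) manifold \<Rightarrow> ('a, 'e) vfield \<Rightarrow> bool" where
  "tangent_to M N V \<longleftrightarrow> (\<forall>p\<in>points M. V p \<in> incl_diff M N p ` tangent_space M p)"

text \<open>A field of \<open>N\<close> that is tangent to \<open>M\<close>, regarded as a field on \<open>M\<close>.\<close>

definition restrict_vfield ::
  "('a, 'f::euclidean_space) manifold \<Rightarrow> ('a, 'e::euclidean_space) manifold \<Rightarrow>
     ('a, 'e) vfield \<Rightarrow> ('a, 'f) vfield" where
  "restrict_vfield M N V p = inv_into (tangent_space M p) (incl_diff M N p) (V p)"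

definition anti_invariant ::
  "('a, 'f::euclidean_space) manifold \<Rightarrow> ('a, 'e::euclidean_space) manifold \<Rightarrow>
     ('a, 'e) endofield \<Rightarrow> ('a, 'e) twotensor \<Rightarrow> bool" where
  "anti_invariant M N \<phi> g \<longleftrightarrow>
     (\<forall>p\<in>points M. \<forall>X\<in>tangent_space M p. \<forall>Y\<in>tangent_space M p.
        g p (\<phi> p (incl_diff M N p X)) (incl_diff M N p Y) = 0)"

end

theory Submission
  imports Defs
begin

text \<open>
  The field \<open>\<xi>\<close> is Killing on \<open>M\<^sup>*\<close>: since \<open>D\<^sub>X \<xi> = -\<beta> \<phi> X\<close> and \<open>\<phi>\<close> is skew,
  \<open>(L\<^sub>\<xi> g)(Y, Z) = g(D\<^sub>Y \<xi>, Z) + g(Y, D\<^sub>Z \<xi>) = 0\<close>. A Killing field tangent to a submanifold restricts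
  to a Killing field of the induced metric, so the soliton equation on \<open>M\<close> reads \<open>S = -\<lambda> g\<close>.
  The restriction step is a computation in charts, which avoids extending vector fields of \<open>M\<close> to
  \<open>M\<^sup>*\<close> and the Gauss formula.
\<close>

section \<open>Calculus in Euclidean spaces\<close>

text \<open>The obstacle in the restriction step is regularity. \<open>restrict_vfield\<close> picks
  a preimage under the differential of the inclusion point by point, so nothing about its smoothness
  is given, while the Lie derivative along it involves its first derivatives. In coordinates,
  however, it solves a linear equation Df(V) = X \<circ> f whose coefficients Df are smooth and
  injective at each point, and differentiability of V at a given point can be extracted from that
  equation; the Killing identity at the point asks for no more. Differentiating this equation brings
  in second derivatives of f, because Df varies from point to point. Their symmetry is what makes
  them cancel, hence the effort spent on it. A device that recurs: Jacobians and metric coefficients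
  are known to be differentiable only for constant vector arguments. Whenever an argument varies, it
  is expanded in \<open>Basis\<close>, which leaves constant arguments and scalar
  coefficients.\<close>

lemma Ck_on_Suc_imp: "Ck_on (Suc k) S f \<Longrightarrow> Ck_on k S f"
proof (induction k arbitrary: f)
  case 0
  then show ?case
    by (auto intro: continuous_at_imp_continuous_on differentiable_imp_continuous_within)
next
  case (Suc k)
  then show ?case
    by (metis Ck_on.simps(2))
qed

text \<open>\<open>frechet_derivative f (at x)\<close> depends on \<open>f\<close> in a full
  neighbourhood of \<open>x\<close>. Agreement on \<open>S\<close> therefore passes to the
  derivatives because \<open>S\<close> is open. The closure lemmas below all use this to replace the
  derivative of a compound map by its explicit formula.\<close>

lemma Ck_on_cong:
  assumes "open S" "\<And>x. x \<in> S \<Longrightarrow> f x = g x" "Ck_on k S f"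
  shows "Ck_on k S g"
  using assms(2,3)
proof (induction k arbitrary: f g)
  case 0
  then show ?case by (simp cong: continuous_on_cong)
next
  case (Suc k)
  have diff: "g differentiable at x" if "x \<in> S" for x
    using Suc.prems that assms(1)
    by (metis Ck_on.simps(2) differentiable_def has_derivative_transform_within_open)
  have eq: "frechet_derivative f (at x) = frechet_derivative g (at x)" if "x \<in> S" for x
    using Suc.prems that assms(1)
    by (metis Ck_on.simps(2) frechet_derivative_transform_within_open)
  have "Ck_on k S (\<lambda>x. frechet_derivative g (at x) v)" for v
    by (rule Suc.IH[of "\<lambda>x. frechet_derivative f (at x) v"]) (use Suc.prems eq in auto)
  with diff show ?case by simp
qed

lemma Ck_on_subset: "Ck_on k S f \<Longrightarrow> T \<subseteq> S \<Longrightarrow> Ck_on k T f"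
  by (induction k arbitrary: f) (auto intro: continuous_on_subset)

lemma Ck_on_const [simp]: "Ck_on k S (\<lambda>x. c)"
  by (induction k arbitrary: c) auto

lemma Ck_on_bounded_linear:
  assumes L: "bounded_linear L" and S: "open S" and f: "Ck_on k S f"
  shows "Ck_on k S (\<lambda>x. L (f x))"
  using f
proof (induction k arbitrary: f)
  case 0
  then show ?case by (simp add: L bounded_linear.continuous_on)
next
  case (Suc k)
  have D: "((\<lambda>x. L (f x)) has_derivative (\<lambda>v. L (frechet_derivative f (at x) v))) (at x)" if "x \<in> S" for x
    using Suc.prems that by (intro bounded_linear.has_derivative[OF L]) (simp add: frechet_derivative_works[THEN iffD1])
  have "Ck_on k S (\<lambda>x. frechet_derivative (\<lambda>x. L (f x)) (at x) v)" for v
    by (rule Ck_on_cong[OF S _ Suc.IH[of "\<lambda>x. frechet_derivative f (at x) v"]])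
      (use Suc.prems in \<open>auto simp: frechet_derivative_at[OF D, symmetric]\<close>)
  with D show ?case by (auto simp: differentiable_def)
qed

lemma Ck_on_add:
  assumes S: "open S" and "Ck_on k S f" "Ck_on k S g"
  shows "Ck_on k S (\<lambda>x. f x + g x)"
  using assms(2,3)
proof (induction k arbitrary: f g)
  case 0
  then show ?case by (simp add: continuous_on_add)
next
  case (Suc k)
  have D: "((\<lambda>x. f x + g x) has_derivative
      (\<lambda>v. frechet_derivative f (at x) v + frechet_derivative g (at x) v)) (at x)" if "x \<in> S" for x
    using Suc.prems that by (intro has_derivative_add) (simp_all add: frechet_derivative_works[THEN iffD1])
  have "Ck_on k S (\<lambda>x. frechet_derivative (\<lambda>x. f x + g x) (at x) v)" for v
    by (rule Ck_on_cong[OF S _ Suc.IH[of "\<lambda>x. frechet_derivative f (at x) v" "\<lambda>x. frechet_derivative g (at x) v"]])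
      (use Suc.prems in \<open>auto simp: frechet_derivative_at[OF D, symmetric]\<close>)
  with D show ?case by (auto simp: differentiable_def)
qed

lemma Ck_on_sum:
  assumes "open S" "finite I" "\<And>i. i \<in> I \<Longrightarrow> Ck_on k S (f i)"
  shows "Ck_on k S (\<lambda>x. \<Sum>i\<in>I. f i x)"
  using assms(2,3) by (induction I) (auto intro: Ck_on_add[OF assms(1)])

lemma Ck_on_scaleR:
  assumes S: "open S" and "Ck_on k S f" "Ck_on k S g"
  shows "Ck_on k S (\<lambda>x. f x *\<^sub>R g x)"
  using assms(2,3)
proof (induction k arbitrary: f g)
  case 0
  then show ?case by (simp add: continuous_on_scaleR)
next
  case (Suc k)
  have D: "((\<lambda>x. f x *\<^sub>R g x) has_derivative
      (\<lambda>v. f x *\<^sub>R frechet_derivative g (at x) v + frechet_derivative f (at x) v *\<^sub>R g x)) (at x)" if "x \<in> S" for x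
    using Suc.prems that by (intro has_derivative_scaleR) (simp_all add: frechet_derivative_works[THEN iffD1])
  have "Ck_on k S (\<lambda>x. frechet_derivative (\<lambda>x. f x *\<^sub>R g x) (at x) v)" for v
  proof (rule Ck_on_cong[OF S])
    show "Ck_on k S (\<lambda>x. f x *\<^sub>R frechet_derivative g (at x) v + frechet_derivative f (at x) v *\<^sub>R g x)"
      \<comment> \<open>The Leibniz rule pairs an undifferentiated factor with a derivative of order
        \<open>k\<close>. Lowering the factors from order \<open>Suc k\<close> to \<open>k\<close>
        puts both products in reach of the induction hypothesis.\<close>
      using Suc.prems Ck_on_Suc_imp[OF Suc.prems(1)] Ck_on_Suc_imp[OF Suc.prems(2)]
      by (intro Ck_on_add S Suc.IH) auto
  qed (simp add: frechet_derivative_at[OF D, symmetric])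
  with D show ?case by (auto simp: differentiable_def)
qed

lemma linear_basis_sum:
  fixes F :: "'e::euclidean_space \<Rightarrow> 'v::real_vector"
  assumes "linear F"
  shows "F v = (\<Sum>b\<in>Basis. (v \<bullet> b) *\<^sub>R F b)"
  by (metis (no_types, lifting) assms euclidean_representation linear_scale linear_sum sum.cong)

text \<open>The chain rule evaluates the derivative of \<open>f\<close> in the direction Dg(x) v,
  which varies with \<open>x\<close>, whereas \<open>Ck_on\<close> controls derivatives in fixed
  directions. Expanding that direction in \<open>Basis\<close> gives a sum of products of partial
  derivatives of \<open>f\<close> composed with \<open>g\<close>, covered by the induction
  hypothesis, and components of the derivative of \<open>g\<close>.\<close>

lemma Ck_on_compose:
  fixes g :: "'e::euclidean_space \<Rightarrow> 'f::euclidean_space"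
  assumes S: "open S" and T: "open T" and sub: "g ` S \<subseteq> T" and "Ck_on k T f" "Ck_on k S g"
  shows "Ck_on k S (\<lambda>x. f (g x))"
  using assms(4,5)
proof (induction k arbitrary: f)
  case 0
  then show ?case using sub by (auto intro: continuous_on_compose2)
next
  case (Suc k)
  let ?Df = "\<lambda>b y. frechet_derivative f (at y) b"
  let ?Dg = "\<lambda>x. frechet_derivative g (at x)"
  have D: "((\<lambda>x. f (g x)) has_derivative (\<lambda>v. frechet_derivative f (at (g x)) (?Dg x v))) (at x)"
    if "x \<in> S" for x
    using Suc.prems that sub
    by (intro diff_chain_at[of g _ x f, unfolded o_def]) (auto intro!: frechet_derivative_works[THEN iffD1])
  have eq: "(\<Sum>b\<in>Basis. (?Dg x v \<bullet> b) *\<^sub>R ?Df b (g x)) = frechet_derivative (\<lambda>x. f (g x)) (at x) v"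
    if "x \<in> S" for x v
  proof -
    have "linear (frechet_derivative f (at (g x)))"
      using Suc.prems that sub by (intro linear_frechet_derivative) auto
    from linear_basis_sum[OF this, of "?Dg x v"] show ?thesis
      by (simp add: frechet_derivative_at[OF D[OF that], symmetric])
  qed
  have "Ck_on k S (\<lambda>x. frechet_derivative (\<lambda>x. f (g x)) (at x) v)" for v
  proof (rule Ck_on_cong[OF S eq])
    have "Ck_on k S (\<lambda>x. ?Df b (g x))" for b
      by (rule Suc.IH) (use Suc.prems Ck_on_Suc_imp in auto)
    moreover have "Ck_on k S (\<lambda>x. ?Dg x v \<bullet> b)" for b
      by (rule Ck_on_bounded_linear[OF bounded_linear_inner_left S]) (use Suc.prems in auto)
    ultimately show "Ck_on k S (\<lambda>x. \<Sum>b\<in>Basis. (?Dg x v \<bullet> b) *\<^sub>R ?Df b (g x))"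
      by (intro Ck_on_sum Ck_on_scaleR S) auto
  qed
  with D show ?case by (auto simp: differentiable_def)
qed

lemma smooth_on_differentiable: "smooth_on S f \<Longrightarrow> x \<in> S \<Longrightarrow> f differentiable at x"
  unfolding smooth_on_def by (metis Ck_on.simps(2))

lemma smooth_on_frechet_derivative:
  "smooth_on S f \<Longrightarrow> smooth_on S (\<lambda>x. frechet_derivative f (at x) v)"
  unfolding smooth_on_def by (metis Ck_on.simps(2))

lemma smooth_on_continuous_on: "smooth_on S f \<Longrightarrow> continuous_on S f"
  unfolding smooth_on_def by (metis Ck_on.simps(1))

lemma smooth_on_subset: "smooth_on S f \<Longrightarrow> T \<subseteq> S \<Longrightarrow> smooth_on T f"
  unfolding smooth_on_def using Ck_on_subset by blast

lemma smooth_on_cong: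
  "open S \<Longrightarrow> (\<And>x. x \<in> S \<Longrightarrow> f x = g x) \<Longrightarrow> smooth_on S f \<Longrightarrow> smooth_on S g"
  unfolding smooth_on_def using Ck_on_cong by blast

lemma smooth_on_compose:
  fixes g :: "'e::euclidean_space \<Rightarrow> 'f::euclidean_space"
  shows "open S \<Longrightarrow> open T \<Longrightarrow> g ` S \<subseteq> T \<Longrightarrow> smooth_on T f \<Longrightarrow> smooth_on S g \<Longrightarrow>
    smooth_on S (\<lambda>x. f (g x))"
  unfolding smooth_on_def using Ck_on_compose by blast

section \<open>Symmetry of second derivatives\<close>

text \<open>The mean value theorem, applied in both orders to a second difference.\<close>

lemma second_difference_mean_value:
  fixes f :: "'e::euclidean_space \<Rightarrow> real"
  assumes t: "0 < t"
    and D1: "\<And>s r. 0 \<le> s \<Longrightarrow> s \<le> t \<Longrightarrow> 0 \<le> r \<Longrightarrow> r \<le> t \<Longrightarrow> f differentiable at (x + s *\<^sub>R u + r *\<^sub>R v)"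
    and D2: "\<And>s r. 0 \<le> s \<Longrightarrow> s \<le> t \<Longrightarrow> 0 \<le> r \<Longrightarrow> r \<le> t \<Longrightarrow>
        (\<lambda>y. frechet_derivative f (at y) u) differentiable at (x + s *\<^sub>R u + r *\<^sub>R v)"
  shows "\<exists>s r. 0 \<le> s \<and> s \<le> t \<and> 0 \<le> r \<and> r \<le> t \<and>
    f (x + t *\<^sub>R u + t *\<^sub>R v) - f (x + t *\<^sub>R u) - f (x + t *\<^sub>R v) + f x
    = t * t * frechet_derivative (\<lambda>y. frechet_derivative f (at y) u) (at (x + s *\<^sub>R u + r *\<^sub>R v)) v"
proof -
  let ?Du = "\<lambda>y. frechet_derivative f (at y) u"
  have lin: "(f has_derivative frechet_derivative f (at y)) (at y)" "linear (frechet_derivative f (at y))"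
    if "f differentiable at y" for y
    using that by (auto intro: frechet_derivative_works[THEN iffD1] linear_frechet_derivative)
  have fd: "((\<lambda>s. f (x + s *\<^sub>R u + r *\<^sub>R v)) has_real_derivative ?Du (x + s *\<^sub>R u + r *\<^sub>R v)) (at s)"
    if "0 \<le> s" "s \<le> t" "0 \<le> r" "r \<le> t" for s r
  proof -
    have "((\<lambda>s. x + s *\<^sub>R u + r *\<^sub>R v) has_derivative (\<lambda>h. h *\<^sub>R u)) (at s)"
      by (auto intro!: derivative_eq_intros)
    from diff_chain_at[OF this lin(1)[OF D1[OF that]]]
    show ?thesis
      unfolding has_field_derivative_def o_def
      by (rule has_derivative_eq_rhs) (simp add: fun_eq_iff linear_scale[OF lin(2)[OF D1[OF that]]])
  qed
  have ud: "((\<lambda>r. ?Du (x + s *\<^sub>R u + r *\<^sub>R v)) has_real_derivative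
      frechet_derivative ?Du (at (x + s *\<^sub>R u + r *\<^sub>R v)) v) (at r)"
    if "0 \<le> s" "s \<le> t" "0 \<le> r" "r \<le> t" for s r
  proof -
    have "((\<lambda>r. x + s *\<^sub>R u + r *\<^sub>R v) has_derivative (\<lambda>h. h *\<^sub>R v)) (at r)"
      by (auto intro!: derivative_eq_intros)
    from diff_chain_at[OF this D2[OF that, unfolded frechet_derivative_works]]
    show ?thesis
      unfolding has_field_derivative_def o_def
      by (rule has_derivative_eq_rhs)
        (simp add: fun_eq_iff linear_scale[OF linear_frechet_derivative[OF D2[OF that]]])
  qed
  have "((\<lambda>s. f (x + s *\<^sub>R u + t *\<^sub>R v) - f (x + s *\<^sub>R u)) has_real_derivative
      ?Du (x + s *\<^sub>R u + t *\<^sub>R v) - ?Du (x + s *\<^sub>R u)) (at s)" if "0 \<le> s" "s \<le> t" for s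
    using fd[OF that, of t] fd[OF that, of 0] t by (auto intro: DERIV_diff)
  then have "\<exists>s>0. s < t \<and> f (x + t *\<^sub>R u + t *\<^sub>R v) - f (x + t *\<^sub>R u)
      - (f (x + 0 *\<^sub>R u + t *\<^sub>R v) - f (x + 0 *\<^sub>R u))
      = (t - 0) * (?Du (x + s *\<^sub>R u + t *\<^sub>R v) - ?Du (x + s *\<^sub>R u))"
    by (intro MVT2[OF t])
  then obtain s where s: "0 < s" "s < t" and
    1: "f (x + t *\<^sub>R u + t *\<^sub>R v) - f (x + t *\<^sub>R u) - (f (x + t *\<^sub>R v) - f x)
      = t * (?Du (x + s *\<^sub>R u + t *\<^sub>R v) - ?Du (x + s *\<^sub>R u))"
    by auto
  have "\<exists>r>0. r < t \<and> ?Du (x + s *\<^sub>R u + t *\<^sub>R v) - ?Du (x + s *\<^sub>R u + 0 *\<^sub>R v)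
      = (t - 0) * frechet_derivative ?Du (at (x + s *\<^sub>R u + r *\<^sub>R v)) v"
    using s by (intro MVT2[OF t ud]) auto
  then obtain r where r: "0 < r" "r < t" and
    2: "?Du (x + s *\<^sub>R u + t *\<^sub>R v) - ?Du (x + s *\<^sub>R u)
      = t * frechet_derivative ?Du (at (x + s *\<^sub>R u + r *\<^sub>R v)) v"
    by auto
  show ?thesis
    using s r 1 2 by (intro exI[of _ s] exI[of _ r]) (simp add: algebra_simps)
qed

lemma smooth_on_inner:
  fixes f :: "'e::euclidean_space \<Rightarrow> 'v::euclidean_space"
  shows "open S \<Longrightarrow> smooth_on S f \<Longrightarrow> smooth_on S (\<lambda>x. f x \<bullet> b)"
  unfolding smooth_on_def using Ck_on_bounded_linear[OF bounded_linear_inner_left] by blast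

lemma frechet_derivative_inner:
  "f differentiable at x \<Longrightarrow>
    frechet_derivative (\<lambda>x. f x \<bullet> b) (at x) = (\<lambda>h. frechet_derivative f (at x) h \<bullet> b)"
  by (intro frechet_derivative_at[symmetric] has_derivative_inner_left) (simp add: frechet_derivative_works)

text \<open>The second difference over the parallelogram spanned by t u and t v does not change when
  u and v are swapped. It equals t * t times either mixed derivative, each taken at some point of
  the parallelogram. Both mixed derivatives are continuous, so for small t their values at
  \<open>x\<close> differ by less than any prescribed bound.\<close>

lemma second_derivative_symmetric_real:
  fixes f :: "'e::euclidean_space \<Rightarrow> real"
  assumes S: "open S" "x \<in> S" and f: "smooth_on S f"
  shows "frechet_derivative (\<lambda>y. frechet_derivative f (at y) u) (at x) v
    = frechet_derivative (\<lambda>y. frechet_derivative f (at y) v) (at x) u"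
    (is "?A u v x = ?A v u x")
proof -
  have cont: "(?A w w' \<longlongrightarrow> ?A w w' x) (nhds x)" for w w'
  proof -
    have "continuous_on S (?A w w')"
      by (intro smooth_on_continuous_on smooth_on_frechet_derivative f)
    with S have "isCont (?A w w') x" by (simp add: continuous_on_eq_continuous_at)
    then show ?thesis
      unfolding continuous_at using tendsto_at_iff_tendsto_nhds[of "?A w w'" x] by (rule iffD1[rotated])
  qed
  have "dist (?A u v x) (?A v u x) < 2 * e" if "0 < e" for e
  proof -
    have "\<forall>\<^sub>F y in nhds x. y \<in> S \<and> dist (?A u v y) (?A u v x) < e \<and> dist (?A v u y) (?A v u x) < e"
      using S that by (intro eventually_conj eventually_nhds_in_open tendstoD cont)
    then obtain d where d: "0 < d" and
      near: "\<And>y. dist y x < d \<Longrightarrow> y \<in> S \<and> dist (?A u v y) (?A u v x) < e \<and> dist (?A v u y) (?A v u x) < e"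
      by (auto simp: eventually_nhds_metric)
    \<comment> \<open>This size keeps the whole parallelogram in the ball of radius
      \<open>d\<close>; the summand 1 keeps the denominator positive when \<open>u\<close> and
      \<open>v\<close> both vanish.\<close>
    define t where "t = d / (norm u + norm v + 1)"
    have pos: "0 < norm u + norm v + 1" by (simp add: add_nonneg_pos)
    have t: "0 < t" "t * (norm u + norm v) < d"
      using d pos by (auto simp: t_def field_simps)
    have box: "dist (x + s *\<^sub>R u + r *\<^sub>R v) x < d" if "0 \<le> s" "s \<le> t" "0 \<le> r" "r \<le> t" for s r
    proof -
      have "dist (x + s *\<^sub>R u + r *\<^sub>R v) x = norm (s *\<^sub>R u + r *\<^sub>R v)"
        by (simp add: dist_norm)
      also have "\<dots> \<le> s * norm u + r * norm v"
        using that norm_triangle_ineq[of "s *\<^sub>R u" "r *\<^sub>R v"] by simp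
      also have "\<dots> \<le> t * norm u + t * norm v"
        using that by (intro add_mono mult_right_mono) auto
      finally show ?thesis using t by (simp add: algebra_simps)
    qed
    have box': "dist (x + s *\<^sub>R v + r *\<^sub>R u) x < d" if "0 \<le> s" "s \<le> t" "0 \<le> r" "r \<le> t" for s r
      using box[of r s] that by (simp add: ac_simps)
    have D: "f differentiable at y" "(\<lambda>y. frechet_derivative f (at y) w) differentiable at y" if "y \<in> S" for y w
      using f that by (auto intro: smooth_on_differentiable smooth_on_frechet_derivative)
    obtain s r where 1: "0 \<le> s" "s \<le> t" "0 \<le> r" "r \<le> t"
        "f (x + t *\<^sub>R u + t *\<^sub>R v) - f (x + t *\<^sub>R u) - f (x + t *\<^sub>R v) + f x
          = t * t * ?A u v (x + s *\<^sub>R u + r *\<^sub>R v)"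
      by (rule second_difference_mean_value[OF t(1), of f x u v, THEN exE])
        (use D near box in auto)
    obtain s' r' where 2: "0 \<le> s'" "s' \<le> t" "0 \<le> r'" "r' \<le> t"
        "f (x + t *\<^sub>R v + t *\<^sub>R u) - f (x + t *\<^sub>R v) - f (x + t *\<^sub>R u) + f x
          = t * t * ?A v u (x + s' *\<^sub>R v + r' *\<^sub>R u)"
      by (rule second_difference_mean_value[OF t(1), of f x v u, THEN exE])
        (use D near box' in auto)
    have "t * t * ?A u v (x + s *\<^sub>R u + r *\<^sub>R v) = t * t * ?A v u (x + s' *\<^sub>R v + r' *\<^sub>R u)"
      unfolding 1(5)[symmetric] 2(5)[symmetric] by (simp add: ac_simps)
    then have eq: "?A u v (x + s *\<^sub>R u + r *\<^sub>R v) = ?A v u (x + s' *\<^sub>R v + r' *\<^sub>R u)"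
      using t(1) by simp
    show ?thesis
      using near[OF box[OF 1(1-4)]] near[OF box'[OF 2(1-4)]] eq unfolding dist_real_def by linarith
  qed
  \<comment> \<open>With half the distance as \<open>e\<close> the bound says that the distance is
    smaller than itself, so the two values cannot be distinct.\<close>
  from this[of "dist (?A u v x) (?A v u x) / 2"] show ?thesis
    by (cases "?A u v x = ?A v u x") auto
qed

lemma second_derivative_symmetric:
  fixes f :: "'e::euclidean_space \<Rightarrow> 'v::euclidean_space"
  assumes S: "open S" "x \<in> S" and f: "smooth_on S f"
  shows "frechet_derivative (\<lambda>y. frechet_derivative f (at y) u) (at x) v
    = frechet_derivative (\<lambda>y. frechet_derivative f (at y) v) (at x) u"
proof (rule euclidean_eqI)
  fix b :: 'v
  have "frechet_derivative (\<lambda>y. frechet_derivative (\<lambda>z. f z \<bullet> b) (at y) w) (at x)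
      = (\<lambda>h. frechet_derivative (\<lambda>y. frechet_derivative f (at y) w) (at x) h \<bullet> b)" for w
  proof -
    have D: "(\<lambda>y. frechet_derivative f (at y) w) differentiable at x"
      by (intro smooth_on_differentiable[OF _ S(2)] smooth_on_frechet_derivative f)
    then have "(\<lambda>y. frechet_derivative f (at y) w \<bullet> b) differentiable at x"
      using has_derivative_inner_left unfolding differentiable_def by blast
    then have
      "frechet_derivative (\<lambda>y. frechet_derivative f (at y) w \<bullet> b) (at x)
        = frechet_derivative (\<lambda>y. frechet_derivative (\<lambda>z. f z \<bullet> b) (at y) w) (at x)"
      by (rule frechet_derivative_transform_within_open[OF _ S])
        (simp add: frechet_derivative_inner[OF smooth_on_differentiable[OF f]])
    then show ?thesis using frechet_derivative_inner[OF D] by (rule trans[OF sym])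
  qed
  note inner = this
  from second_derivative_symmetric_real[OF S smooth_on_inner[OF S(1) f], of b u v]
  show "frechet_derivative (\<lambda>y. frechet_derivative f (at y) u) (at x) v \<bullet> b
      = frechet_derivative (\<lambda>y. frechet_derivative f (at y) v) (at x) u \<bullet> b"
    unfolding inner .
qed

section \<open>Linear equations and families of linear or bilinear maps\<close>

text \<open>At a zero of \<open>g\<close> the product rule loses the term containing the derivative
  of \<open>f\<close>, and continuity of \<open>f\<close> is enough. This breaks a circle in the
  next lemma, where \<open>f\<close> is a component of the very map whose differentiability is
  sought.\<close>

lemma has_derivative_scaleR_vanishing:
  fixes f :: "'e::real_normed_vector \<Rightarrow> real" and g :: "'e \<Rightarrow> 'v::real_normed_vector"
  assumes f: "isCont f x" and g: "(g has_derivative g') (at x)" and 0: "g x = 0"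
  shows "((\<lambda>y. f y *\<^sub>R g y) has_derivative (\<lambda>h. f x *\<^sub>R g' h)) (at x)"
proof -
  have bl: "bounded_linear g'" using g by (rule has_derivative_bounded_linear)
  then obtain K where K: "\<And>h. norm (g' h) \<le> norm h * K" by (auto dest: bounded_linear.bounded)
  define q where "q h = norm (g (x + h) - g x - g' h) / norm h" for h
  have q: "q \<midarrow>0\<rightarrow> 0" using g by (simp add: has_derivative_at q_def[abs_def])
  have fx: "(\<lambda>h. f (x + h) - f x) \<midarrow>0\<rightarrow> 0"
    using f LIM_zero by (auto simp: isCont_iff)
  have "(\<lambda>h. \<bar>f (x + h)\<bar> * q h + \<bar>f (x + h) - f x\<bar> * K) \<midarrow>0\<rightarrow> \<bar>f x\<bar> * 0 + \<bar>0\<bar> * K"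
    using f q fx by (intro tendsto_intros) (auto simp: isCont_iff)
  then have lim: "(\<lambda>h. \<bar>f (x + h)\<bar> * q h + \<bar>f (x + h) - f x\<bar> * K) \<midarrow>0\<rightarrow> 0" by simp
  have "(\<lambda>h. norm (f (x + h) *\<^sub>R g (x + h) - f x *\<^sub>R g x - f x *\<^sub>R g' h) / norm h) \<midarrow>0\<rightarrow> 0"
  proof (rule real_tendsto_sandwich[OF _ _ tendsto_const lim])
    show "\<forall>\<^sub>F h in at 0. norm (f (x + h) *\<^sub>R g (x + h) - f x *\<^sub>R g x - f x *\<^sub>R g' h) / norm h
        \<le> \<bar>f (x + h)\<bar> * q h + \<bar>f (x + h) - f x\<bar> * K"
    proof (rule eventually_at_filter[THEN iffD2], rule always_eventually, safe)
      fix h :: 'e assume h: "h \<noteq> 0"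
      \<comment> \<open>The first summand is a bounded factor times the remainder of
        \<open>g\<close>; in the second, continuity of \<open>f\<close> makes the factor in front of
        the linear term \<open>g' h\<close> small.\<close>
      have "f (x + h) *\<^sub>R g (x + h) - f x *\<^sub>R g x - f x *\<^sub>R g' h
          = f (x + h) *\<^sub>R (g (x + h) - g x - g' h) + (f (x + h) - f x) *\<^sub>R g' h"
        by (simp add: 0 algebra_simps)
      also have "norm \<dots> \<le> \<bar>f (x + h)\<bar> * norm (g (x + h) - g x - g' h) + \<bar>f (x + h) - f x\<bar> * (norm h * K)"
        using K[of h] by (intro norm_triangle_le add_mono) (auto intro: mult_left_mono)
      finally show "norm (f (x + h) *\<^sub>R g (x + h) - f x *\<^sub>R g x - f x *\<^sub>R g' h) / norm h
          \<le> \<bar>f (x + h)\<bar> * q h + \<bar>f (x + h) - f x\<bar> * K"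
        using h by (simp add: q_def field_simps)
    qed
  qed simp
  then show ?thesis
    using bl by (simp add: has_derivative_at bounded_linear_const_scaleR)
qed

text \<open>After composing \<open>A x\<close> with a left inverse of \<open>A x0\<close> we may assume \<open>A x0 = id\<close>;
  then \<open>V x = w x + (id - A x) (V x)\<close>, where the operator \<open>id - A x\<close> vanishes at \<open>x0\<close>.\<close>

lemma differentiable_solution_linear_equation:
  fixes A :: "'e::real_normed_vector \<Rightarrow> 'f::euclidean_space \<Rightarrow> 'g::euclidean_space"
  assumes S: "open S" "x0 \<in> S" and lin: "\<And>x. x \<in> S \<Longrightarrow> linear (A x)"
    and A: "\<And>u. (\<lambda>x. A x u) differentiable at x0" and inj: "inj (A x0)"
    and w: "w differentiable at x0" and eq: "\<And>x. x \<in> S \<Longrightarrow> A x (V x) = w x"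
  shows "V differentiable at x0"
proof -
  obtain P where P: "linear P" "P \<circ> A x0 = id"
    using linear_injective_left_inverse[OF lin[OF S(2)] inj] by blast
  have Pb: "bounded_linear P" using P(1) by (simp add: linear_conv_bounded_linear)
  have Pd: "(\<lambda>x. P (h x)) differentiable at x0" if "h differentiable at x0" for h :: "'e \<Rightarrow> 'g"
    using that bounded_linear.has_derivative[OF Pb] unfolding differentiable_def by blast
  define z where "z b x = b - P (A x b)" for b x
  define e where "e x = (\<Sum>b\<in>Basis. norm (z b x))" for x
  have zd: "z b differentiable at x0" for b
    unfolding z_def[abs_def] by (intro differentiable_diff Pd A) auto
  have Pw: "(\<lambda>x. P (w x)) differentiable at x0" by (rule Pd[OF w])
  have z0: "z b x0 = 0" for b using P(2) by (simp add: z_def fun_eq_iff)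
  have V: "V x = P (w x) + (\<Sum>b\<in>Basis. (V x \<bullet> b) *\<^sub>R z b x)" if "x \<in> S" for x
  proof -
    have "linear (\<lambda>v. v - P (A x v))"
      using linear_compose[OF lin[OF that] P(1)] by (intro linear_compose_sub linear_ident) (simp add: o_def)
    from linear_basis_sum[OF this, of "V x"] show ?thesis
      using eq[OF that] by (simp add: z_def algebra_simps)
  qed
  have bound: "norm (V x - P (w x)) \<le> norm (V x) * e x" if "x \<in> S" for x
  proof -
    have "norm (V x - P (w x)) \<le> (\<Sum>b\<in>Basis. norm ((V x \<bullet> b) *\<^sub>R z b x))"
      using V[OF that] by (metis add_diff_cancel_left' norm_sum)
    also have "\<dots> \<le> (\<Sum>b\<in>Basis. norm (V x) * norm (z b x))"
      by (intro sum_mono) (simp add: Basis_le_norm mult_right_mono)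
    finally show ?thesis by (simp add: e_def sum_distrib_left)
  qed
  have Pwc: "((\<lambda>x. P (w x)) \<longlongrightarrow> P (w x0)) (at x0)"
    using differentiable_imp_continuous_within[OF Pw] by (simp add: continuous_within)
  have "(e \<longlongrightarrow> (\<Sum>b\<in>Basis. norm (z b x0))) (at x0)"
    unfolding e_def[abs_def] using differentiable_imp_continuous_within[OF zd]
    by (intro tendsto_intros) (simp add: continuous_within)
  then have e: "(e \<longlongrightarrow> 0) (at x0)" by (simp add: z0)
  have ev: "\<forall>\<^sub>F x in at x0. x \<in> S \<and> e x < 1/2"
    using S order_tendstoD(2)[OF e, of "1/2"] by (intro eventually_conj eventually_at_in_open') auto
  have "((\<lambda>x. V x - P (w x)) \<longlongrightarrow> 0) (at x0)"
  proof (rule Lim_null_comparison)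
    show "\<forall>\<^sub>F x in at x0. norm (V x - P (w x)) \<le> 2 * norm (P (w x)) * e x"
      using ev
    proof eventually_elim
      case (elim x)
      have e0: "0 \<le> e x" by (simp add: e_def sum_nonneg)
      \<comment> \<open>No bound on \<open>V\<close> is known beforehand. Since
        \<open>e x < 1/2\<close>, half of \<open>norm (V x)\<close> can be absorbed on the left,
        which bounds \<open>V\<close> near \<open>x0\<close> by its main part
        \<open>P (w x)\<close>. Inserted once more into \<open>bound\<close>, this yields continuity
        at \<open>x0\<close>.\<close>
      have "norm (V x) \<le> norm (P (w x)) + norm (V x - P (w x))"
        using norm_triangle_ineq[of "P (w x)" "V x - P (w x)"] by simp
      also have "\<dots> \<le> norm (P (w x)) + norm (V x) * (1/2)"
        using bound[of x] elim mult_left_mono[of "e x" "1/2" "norm (V x)"] by simp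
      finally have "norm (V x) \<le> 2 * norm (P (w x))" by simp
      with bound[of x] elim e0 show ?case
        by (meson mult_right_mono order_trans)
    qed
    have "((\<lambda>x. 2 * norm (P (w x)) * e x) \<longlongrightarrow> 2 * norm (P (w x0)) * 0) (at x0)"
      by (intro tendsto_intros Pwc e)
    then show "((\<lambda>x. 2 * norm (P (w x)) * e x) \<longlongrightarrow> 0) (at x0)" by simp
  qed
  from tendsto_add[OF this Pwc] have "(V \<longlongrightarrow> V x0) (at x0)"
    using V[OF S(2)] by (simp add: z0)
  then have Vc: "isCont (\<lambda>x. V x \<bullet> b) x0" for b
    by (auto simp: continuous_at intro: tendsto_inner)
  \<comment> \<open>The coefficients are so far only continuous at \<open>x0\<close>, which suffices
    because \<open>z b\<close> vanishes there.\<close>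
  have "(\<lambda>x. (V x \<bullet> b) *\<^sub>R z b x) differentiable at x0" for b
    using has_derivative_scaleR_vanishing[OF Vc zd[unfolded frechet_derivative_works] z0]
    unfolding differentiable_def by blast
  then have "(\<lambda>x. P (w x) + (\<Sum>b\<in>Basis. (V x \<bullet> b) *\<^sub>R z b x)) differentiable at x0"
    by (intro differentiable_add Pw differentiable_sum) auto
  then show ?thesis
    using V S has_derivative_transform_within_open unfolding differentiable_def by (metis (no_types, lifting))
qed

text \<open>Expanding \<open>a x\<close> in \<open>Basis\<close> reduces the claim to the product
  rule with constant vectors. Linearity is required only near \<open>x0\<close>, because Jacobians
  and metric coefficients are linear only where their charts are defined.\<close>

lemma has_derivative_linear_family:
  fixes A :: "'e::real_normed_vector \<Rightarrow> 'f::euclidean_space \<Rightarrow> 'g::real_normed_vector"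
  assumes lin: "\<forall>\<^sub>F x in nhds x0. linear (A x)"
    and A: "\<And>u. ((\<lambda>x. A x u) has_derivative A' u) (at x0)"
    and a: "(a has_derivative a') (at x0)"
  shows "((\<lambda>x. A x (a x)) has_derivative (\<lambda>h. A' (a x0) h + A x0 (a' h))) (at x0)"
proof -
  have lin0: "linear (A x0)" using lin by (rule eventually_nhds_x_imp_x)
  have ev: "\<forall>\<^sub>F x in nhds x0. (\<Sum>b\<in>Basis. (u x \<bullet> b) *\<^sub>R A x b) = A x (u x)" for u
    using lin by eventually_elim (simp add: linear_basis_sum[symmetric])
  have transform: "((\<lambda>x. A x (u x)) has_derivative F) (at x0)"
    if "((\<lambda>x. \<Sum>b\<in>Basis. (u x \<bullet> b) *\<^sub>R A x b) has_derivative F) (at x0)" for u F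
    using eventually_nhds_x_imp_x[OF ev[of u]] ev[of u]
    by (intro has_derivative_transform_eventually[OF that]) (auto simp: eventually_at_filter elim: eventually_mono)
  \<comment> \<open>\<open>A' u\<close> is not assumed to be linear in \<open>u\<close>. Uniqueness
    of derivatives supplies its expansion in \<open>Basis\<close>.\<close>
  have "((\<lambda>x. \<Sum>b\<in>Basis. (u \<bullet> b) *\<^sub>R A x b) has_derivative (\<lambda>h. \<Sum>b\<in>Basis. (u \<bullet> b) *\<^sub>R A' b h)) (at x0)" for u
    by (intro has_derivative_sum has_derivative_scaleR_right A)
  from has_derivative_unique[OF A transform[of "\<lambda>_. u" for u, OF this]]
  have A': "A' u = (\<lambda>h. \<Sum>b\<in>Basis. (u \<bullet> b) *\<^sub>R A' b h)" for u .
  have "((\<lambda>x. A x (a x)) has_derivative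
      (\<lambda>h. \<Sum>b\<in>Basis. (a x0 \<bullet> b) *\<^sub>R A' b h + (a' h \<bullet> b) *\<^sub>R A x0 b)) (at x0)"
    by (intro transform has_derivative_sum has_derivative_scaleR has_derivative_inner_left A a)
  then show ?thesis
    by (rule has_derivative_eq_rhs)
      (simp add: fun_eq_iff sum.distrib A'[of "a x0"] linear_basis_sum[OF lin0, of "a' _"])
qed

text \<open>The linear case is applied twice: to the first slot with a constant second argument,
  then to the second slot.\<close>

lemma has_derivative_bilinear_family:
  fixes B :: "'e::real_normed_vector \<Rightarrow> 'f::euclidean_space \<Rightarrow> 'f \<Rightarrow> real"
  assumes bil: "\<forall>\<^sub>F y in nhds (f x0). bilinear (B y)"
    and B: "\<And>u v. ((\<lambda>y. B y u v) has_derivative B' u v) (at (f x0))"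
    and f: "(f has_derivative f') (at x0)"
    and a: "(a has_derivative a') (at x0)" and b: "(b has_derivative b') (at x0)"
  shows "((\<lambda>x. B (f x) (a x) (b x)) has_derivative
    (\<lambda>h. B' (a x0) (b x0) (f' h) + B (f x0) (a' h) (b x0) + B (f x0) (a x0) (b' h))) (at x0)"
proof -
  have "(f \<longlongrightarrow> f x0) (nhds x0)"
    using has_derivative_continuous[OF f] by (simp add: continuous_at tendsto_at_iff_tendsto_nhds)
  then have bil': "\<forall>\<^sub>F x in nhds x0. bilinear (B (f x))"
    using bil by (rule eventually_compose_filterlim[rotated])
  have "((\<lambda>x. B (f x) (a x) v) has_derivative (\<lambda>h. B' (a x0) v (f' h) + B (f x0) (a' h) v)) (at x0)" for v
    using bil' has_derivative_compose[OF f B]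
    by (intro has_derivative_linear_family[where A = "\<lambda>x u. B (f x) u v" and A' = "\<lambda>u h. B' u v (f' h)", OF _ _ a])
      (auto simp: bilinear_def elim: eventually_mono)
  then show ?thesis
    using bil'
    by (intro has_derivative_linear_family[where A = "\<lambda>x v. B (f x) (a x) v", OF _ _ b])
      (auto simp: bilinear_def elim: eventually_mono)
qed

lemma has_derivative_frechet_derivative_apply:
  fixes f :: "'e::euclidean_space \<Rightarrow> 'g::real_normed_vector"
  assumes S: "open S" "x0 \<in> S" and f: "smooth_on S f" and Y: "(Y has_derivative Y') (at x0)"
  shows "((\<lambda>x. frechet_derivative f (at x) (Y x)) has_derivative
    (\<lambda>h. frechet_derivative (\<lambda>x. frechet_derivative f (at x) (Y x0)) (at x0) h
      + frechet_derivative f (at x0) (Y' h))) (at x0)"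
proof (rule has_derivative_linear_family[OF _ _ Y])
  show "\<forall>\<^sub>F x in nhds x0. linear (frechet_derivative f (at x))"
    using eventually_nhds_in_open[OF S]
    by eventually_elim (intro linear_frechet_derivative smooth_on_differentiable[OF f])
  show "((\<lambda>x. frechet_derivative f (at x) u) has_derivative
      frechet_derivative (\<lambda>x. frechet_derivative f (at x) u) (at x0)) (at x0)" for u
    using smooth_on_differentiable[OF smooth_on_frechet_derivative[OF f] S(2)]
    by (simp add: frechet_derivative_works)
qed

text \<open>If \<open>X\<close> is Killing for \<open>B\<close> at \<open>f x0\<close> and \<open>f\<close>-related to \<open>V\<close>, then \<open>V\<close> is Killing for the
  pullback of \<open>B\<close>: differentiating \<open>Df (V) = X \<circ> f\<close> along \<open>Y\<close> and using the symmetry of the second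
  derivative of \<open>f\<close> turns the terms in \<open>[V, Y]\<close> and \<open>[V, Z]\<close> into terms in \<open>X'\<close>.\<close>

lemma killing_pullback_coordinates:
  fixes f :: "'f::euclidean_space \<Rightarrow> 'e::euclidean_space" and B :: "'e \<Rightarrow> 'e \<Rightarrow> 'e \<Rightarrow> real"
  defines "F \<equiv> \<lambda>x. frechet_derivative f (at x)"
  assumes S: "open S" "x0 \<in> S" and f: "smooth_on S f"
    and bil: "\<forall>\<^sub>F y in nhds (f x0). bilinear (B y)"
    and B: "\<And>u v. ((\<lambda>y. B y u v) has_derivative B' u v) (at (f x0))"
    and X: "(X has_derivative X') (at (f x0))"
    and kill: "\<And>u v. B' u v (X (f x0)) + B (f x0) (X' u) v + B (f x0) u (X' v) = 0"
    and V: "(V has_derivative V') (at x0)" and rel: "\<And>x. x \<in> S \<Longrightarrow> F x (V x) = X (f x)"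
    and Y: "(Y has_derivative Y') (at x0)" and Z: "(Z has_derivative Z') (at x0)"
  shows "frechet_derivative (\<lambda>x. B (f x) (F x (Y x)) (F x (Z x))) (at x0) (V x0)
    = B (f x0) (F x0 (Y' (V x0) - V' (Y x0))) (F x0 (Z x0))
    + B (f x0) (F x0 (Y x0)) (F x0 (Z' (V x0) - V' (Z x0)))"
proof -
  define H where "H u = frechet_derivative (\<lambda>x. F x u) (at x0)" for u
  have f': "(f has_derivative F x0) (at x0)"
    using smooth_on_differentiable[OF f S(2)] by (simp add: F_def frechet_derivative_works)
  have DF: "((\<lambda>x. F x (W x)) has_derivative (\<lambda>h. H (W x0) h + F x0 (W' h))) (at x0)"
    if "(W has_derivative W') (at x0)" for W W'
    unfolding F_def H_def using S f that by (rule has_derivative_frechet_derivative_apply)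
  have sym: "H u v = H v u" for u v
    unfolding H_def F_def using S f by (rule second_derivative_symmetric)
  have "((\<lambda>x. F x (V x)) has_derivative (\<lambda>h. X' (F x0 h))) (at x0)"
    using has_derivative_transform_within_open[OF has_derivative_compose[OF f' X] S] rel by simp
  \<comment> \<open>Symmetry puts \<open>V x0\<close> in the second place of \<open>H\<close>. For
    \<open>h = Y x0\<close> this is the term that arises when F(Y) is differentiated along
    \<open>V x0\<close>, and likewise for \<open>Z\<close>, so all second-order terms cancel after
    \<open>kill\<close> is inserted.\<close>
  from has_derivative_unique[OF this DF[OF V]]
  have X': "X' (F x0 h) = H h (V x0) + F x0 (V' h)" for h
    by (simp add: fun_eq_iff sym)
  have lin: "linear (F x0)" using f' by (rule has_derivative_linear)
  have bl: "bilinear (B (f x0))" using bil by (rule eventually_nhds_x_imp_x)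
  have "((\<lambda>x. B (f x) (F x (Y x)) (F x (Z x))) has_derivative
      (\<lambda>h. B' (F x0 (Y x0)) (F x0 (Z x0)) (F x0 h)
        + B (f x0) (H (Y x0) h + F x0 (Y' h)) (F x0 (Z x0))
        + B (f x0) (F x0 (Y x0)) (H (Z x0) h + F x0 (Z' h)))) (at x0)"
    by (intro has_derivative_bilinear_family bil B f' DF Y Z)
  from frechet_derivative_at[OF this, symmetric]
  have "frechet_derivative (\<lambda>x. B (f x) (F x (Y x)) (F x (Z x))) (at x0) (V x0)
    = B' (F x0 (Y x0)) (F x0 (Z x0)) (F x0 (V x0))
    + B (f x0) (H (Y x0) (V x0) + F x0 (Y' (V x0))) (F x0 (Z x0))
    + B (f x0) (F x0 (Y x0)) (H (Z x0) (V x0) + F x0 (Z' (V x0)))"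
    by simp
  with kill[of "F x0 (Y x0)" "F x0 (Z x0)"] show ?thesis
    by (simp add: X' rel[OF S(2)] linear_diff[OF lin] bilinear_ladd[OF bl] bilinear_radd[OF bl]
        bilinear_lsub[OF bl] bilinear_rsub[OF bl])
qed

section \<open>Charts, tangent vectors and inclusions\<close>

lemma
  assumes "c \<in> charts_at M p"
  shows charts_at_atlas: "c \<in> atlas M" and charts_at_mem: "p \<in> fst c"
  using assms by (auto simp: charts_at_def)

lemma
  assumes M: "smooth_manifold M" and c: "c \<in> atlas M"
  shows openin_chart: "openin (mtop M) (fst c)"
    and chart_subset: "fst c \<subseteq> points M"
    and chart_inv_chart: "q \<in> fst c \<Longrightarrow> chart_inv c (snd c q) = q"
    and open_chart_image: "openin (mtop M) W \<Longrightarrow> W \<subseteq> fst c \<Longrightarrow> open (snd c ` W)"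
proof -
  from M c show op: "openin (mtop M) (fst c)" by (simp add: smooth_manifold_def)
  then show sub: "fst c \<subseteq> points M" by (rule openin_subset)
  have hom: "homeomorphic_map (subtopology (mtop M) (fst c)) (top_of_set (snd c ` fst c)) (snd c)"
    and oi: "open (snd c ` fst c)"
    using M c by (auto simp: smooth_manifold_def)
  from hom have "inj_on (snd c) (fst c)"
    using sub by (auto simp: homeomorphic_eq_everything_map Int_absorb1)
  then show "q \<in> fst c \<Longrightarrow> chart_inv c (snd c q) = q"
    by (simp add: chart_inv_def)
  show "open (snd c ` W)" if W: "openin (mtop M) W" "W \<subseteq> fst c"
  proof -
    have "openin (subtopology (mtop M) (fst c)) W"
      using W op by (simp add: openin_open_subtopology)
    then have "openin (top_of_set (snd c ` fst c)) (snd c ` W)"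
      using hom by (auto simp: homeomorphic_eq_everything_map open_map_def)
    then show ?thesis using oi by (simp add: openin_open_eq)
  qed
qed

lemma chart_at_charts_at:
  assumes "smooth_manifold M" "p \<in> points M"
  shows "chart_at M p \<in> charts_at M p"
proof -
  have "p \<in> (\<Union>c\<in>atlas M. fst c)" using assms by (simp add: smooth_manifold_def)
  then obtain c where "c \<in> charts_at M p" by (auto simp: charts_at_def)
  then show ?thesis unfolding chart_at_def by (rule someI)
qed

text \<open>A change of charts and the coordinate form of an inclusion are both given by
  \<open>snd d \<circ> chart_inv c\<close>. This notion covers the two at once, the former with
  \<open>N = M\<close>, so that the calculus of Jacobians is done a single time.\<close>

definition smooth_inclusion ::
  "('a, 'f::euclidean_space) manifold \<Rightarrow> ('a, 'e::euclidean_space) manifold \<Rightarrow> bool" where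
  "smooth_inclusion M N \<longleftrightarrow> smooth_manifold M \<and> smooth_manifold N \<and> smooth_map M N (\<lambda>p. p)"

lemma smooth_inclusion_refl: "smooth_manifold M \<Longrightarrow> smooth_inclusion M M"
  by (auto simp: smooth_inclusion_def smooth_map_def smooth_manifold_def comp_def)

lemma submanifold_smooth_inclusion: "submanifold M N \<Longrightarrow> smooth_inclusion M N"
  by (simp add: submanifold_def smooth_inclusion_def)

abbreviation jac :: "'a \<Rightarrow> ('a, 'f::euclidean_space) chart \<Rightarrow> ('a, 'e::euclidean_space) chart \<Rightarrow> 'f \<Rightarrow> 'e" where
  "jac p c d \<equiv> frechet_derivative (snd d \<circ> chart_inv c) (at (snd c p))"

text \<open>The topology of \<open>M\<close> may be finer than the subspace topology, and
  \<open>fst d\<close> need not lie in \<open>M\<close>. Continuity of the inclusion is what makes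
  the overlap of a chart of \<open>M\<close> with a chart of \<open>N\<close> open in
  \<open>M\<close>.\<close>

lemma
  assumes i: "smooth_inclusion M N" and c: "c \<in> atlas M" and d: "d \<in> atlas N"
  shows openin_overlap: "openin (mtop M) (fst c \<inter> fst d)"
    and open_overlap_image: "open (snd c ` (fst c \<inter> fst d))"
    and smooth_on_transition: "smooth_on (snd c ` (fst c \<inter> fst d)) (snd d \<circ> chart_inv c)"
proof -
  have M: "smooth_manifold M" "smooth_manifold N" and f: "smooth_map M N (\<lambda>p. p)"
    using i by (auto simp: smooth_inclusion_def)
  have "openin (mtop M) {p \<in> points M. p \<in> fst d}"
    using f openin_chart[OF M(2) d] unfolding smooth_map_def
    by (auto intro: openin_continuous_map_preimage)
  moreover have "fst c \<inter> fst d = fst c \<inter> {p \<in> points M. p \<in> fst d}"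
    using chart_subset[OF M(1) c] by auto
  ultimately show "openin (mtop M) (fst c \<inter> fst d)"
    using openin_chart[OF M(1) c] by (simp add: openin_Int)
  then show "open (snd c ` (fst c \<inter> fst d))"
    by (rule open_chart_image[OF M(1) c]) simp
  show "smooth_on (snd c ` (fst c \<inter> fst d)) (snd d \<circ> chart_inv c)"
    using f c d by (auto simp: smooth_map_def comp_def)
qed

lemma
  assumes "smooth_inclusion M N" "c \<in> charts_at M p" "d \<in> charts_at N p"
  shows transition_has_derivative: "(snd d \<circ> chart_inv c has_derivative jac p c d) (at (snd c p))"
    and linear_jac: "linear (jac p c d)"
proof -
  have "(snd d \<circ> chart_inv c) differentiable at (snd c p)"
    using assms by (intro smooth_on_differentiable[OF smooth_on_transition]) (auto simp: charts_at_def)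
  then show "(snd d \<circ> chart_inv c has_derivative jac p c d) (at (snd c p))" "linear (jac p c d)"
    by (auto simp: frechet_derivative_works intro: linear_frechet_derivative)
qed

text \<open>This cocycle identity is the source of all chart independence below. With three equal
  manifolds it shows that coordinate fields transform as tangent vectors. With \<open>P = N\<close>
  it does the same for images under \<open>incl_diff\<close>, and with \<open>N = M\<close> in the
  middle it frees \<open>incl_diff\<close> from the chosen chart of the source.\<close>

lemma jac_chain:
  assumes i: "smooth_inclusion M N" "smooth_inclusion N P"
    and c: "c \<in> charts_at M p" and d: "d \<in> charts_at N p" and e: "e \<in> charts_at P p"
  shows "jac p c e v = jac p d e (jac p c d v)"
proof -
  have M: "smooth_manifold M" "smooth_manifold N" using i by (auto simp: smooth_inclusion_def)
  have ca: "c \<in> atlas M" "p \<in> fst c" and da: "d \<in> atlas N" "p \<in> fst d"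
    using c d by (auto simp: charts_at_def)
  have pt: "(snd d \<circ> chart_inv c) (snd c p) = snd d p"
    by (simp add: chart_inv_chart[OF M(1)] ca)
  have "((snd e \<circ> chart_inv d) \<circ> (snd d \<circ> chart_inv c) has_derivative jac p d e \<circ> jac p c d) (at (snd c p))"
    by (rule diff_chain_at[OF transition_has_derivative[OF i(1) c d]])
      (unfold pt, rule transition_has_derivative[OF i(2) d e])
  then have "(snd e \<circ> chart_inv c has_derivative jac p d e \<circ> jac p c d) (at (snd c p))"
    by (rule has_derivative_transform_within_open[OF _ open_overlap_image[OF i(1) ca(1) da(1)]])
      (use ca da in \<open>auto simp: chart_inv_chart[OF M(1)] chart_inv_chart[OF M(2)]\<close>)
  from frechet_derivative_at[OF this, symmetric] show ?thesis by simp
qed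

lemma jac_self:
  assumes M: "smooth_manifold M" and c: "c \<in> charts_at M p"
  shows "jac p c c v = v"
proof -
  have ca: "c \<in> atlas M" "p \<in> fst c" using c by (auto simp: charts_at_def)
  have "((\<lambda>x. x) has_derivative (\<lambda>x. x)) (at (snd c p))" by simp
  then have "(snd c \<circ> chart_inv c has_derivative (\<lambda>x. x)) (at (snd c p))"
    by (rule has_derivative_transform_within_open[OF _ open_chart_image[OF M ca(1) openin_chart[OF M ca(1)]]])
      (use ca in \<open>auto simp: chart_inv_chart[OF M]\<close>)
  from frechet_derivative_at[OF this, symmetric] show ?thesis by simp
qed

lemma tangent_space_change_chart:
  "v \<in> tangent_space M p \<Longrightarrow> c \<in> charts_at M p \<Longrightarrow> d \<in> charts_at M p \<Longrightarrow> v d = jac p c d (v c)"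
  unfolding tangent_space_def by blast

lemma tangent_space_outside: "v \<in> tangent_space M p \<Longrightarrow> d \<notin> charts_at M p \<Longrightarrow> v d = 0"
  unfolding tangent_space_def by blast

lemma tangent_spaceI:
  assumes "\<And>d. d \<notin> charts_at M p \<Longrightarrow> v d = 0"
    and "\<And>c d. c \<in> charts_at M p \<Longrightarrow> d \<in> charts_at M p \<Longrightarrow> v d = jac p c d (v c)"
  shows "v \<in> tangent_space M p"
  using assms unfolding tangent_space_def by blast

lemma tangent_space_eqI:
  assumes "u \<in> tangent_space M p" "v \<in> tangent_space M p" "c \<in> charts_at M p" "u c = v c"
  shows "u = v"
proof
  show "u d = v d" for d
    using tangent_space_change_chart[OF assms(1,3)] tangent_space_change_chart[OF assms(2,3)]
      tangent_space_outside[OF assms(1)] tangent_space_outside[OF assms(2)] assms(4)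
    by metis
qed

lemma
  assumes M: "smooth_manifold M" and u: "u \<in> tangent_space M p"
  shows tangent_space_scale: "r *\<^sub>T u \<in> tangent_space M p"
    and tangent_space_diff: "v \<in> tangent_space M p \<Longrightarrow> u - v \<in> tangent_space M p"
proof -
  note lin = linear_jac[OF smooth_inclusion_refl[OF M]]
  show "r *\<^sub>T u \<in> tangent_space M p"
  proof (rule tangent_spaceI)
    show "(r *\<^sub>T u) d = jac p c d ((r *\<^sub>T u) c)" if "c \<in> charts_at M p" "d \<in> charts_at M p" for c d
      unfolding tscale_def linear_scale[OF lin[OF that]] tangent_space_change_chart[OF u that] ..
  qed (simp add: tscale_def tangent_space_outside[OF u])
  show "u - v \<in> tangent_space M p" if v: "v \<in> tangent_space M p"
  proof (rule tangent_spaceI)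
    show "(u - v) d = jac p c d ((u - v) c)" if "c \<in> charts_at M p" "d \<in> charts_at M p" for c d
      unfolding minus_apply linear_diff[OF lin[OF that]] tangent_space_change_chart[OF u that]
        tangent_space_change_chart[OF v that] ..
  qed (simp add: tangent_space_outside[OF u] tangent_space_outside[OF v])
qed

lemma
  assumes M: "smooth_manifold M" and c: "c \<in> charts_at M p"
  shows coord_field_tangent: "coord_field M c b p \<in> tangent_space M p"
    and coord_field_self: "coord_field M c b p c = b"
    and coord_field_add: "coord_field M c (b + b') p = coord_field M c b p + coord_field M c b' p"
    and coord_field_scale: "coord_field M c (r *\<^sub>R b) p = r *\<^sub>T coord_field M c b p"
proof -
  note i = smooth_inclusion_refl[OF M]
  show "coord_field M c b p \<in> tangent_space M p"
  proof (rule tangent_spaceI)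
    show "coord_field M c b p e = jac p d e (coord_field M c b p d)"
      if "d \<in> charts_at M p" "e \<in> charts_at M p" for d e
      using jac_chain[OF i i c that, of b] c that by (simp only: coord_field_def simp_thms if_True)
  qed (simp add: coord_field_def)
  show "coord_field M c b p c = b"
    using jac_self[OF M c] c by (simp add: coord_field_def)
  show "coord_field M c (b + b') p = coord_field M c b p + coord_field M c b' p"
    "coord_field M c (r *\<^sub>R b) p = r *\<^sub>T coord_field M c b p"
    using linear_jac[OF i c] c by (auto simp: coord_field_def tscale_def linear_add linear_scale)
qed

lemma tangent_space_eq_coord_field:
  assumes "smooth_manifold M" "v \<in> tangent_space M p" "c \<in> charts_at M p"
  shows "v = coord_field M c (v c) p"
  using assms by (intro tangent_space_eqI[of v M p _ c]) (auto intro: coord_field_tangent simp: coord_field_self)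

text \<open>In another chart the components are a directional derivative of one transition map
  composed with the inverse transition. These fields are the test fields that turn hypotheses about
  all smooth local fields into statements about coordinates.\<close>

lemma smooth_vfield_coord_field:
  assumes M: "smooth_manifold M" and c: "c \<in> atlas M"
  shows "smooth_vfield M (fst c) (coord_field M c b)"
  unfolding smooth_vfield_def
proof safe
  note i = smooth_inclusion_refl[OF M]
  show "coord_field M c b p \<in> tangent_space M p" if "p \<in> fst c" for p
    using that c by (intro coord_field_tangent[OF M]) (simp add: charts_at_def)
  fix A h assume d: "(A, h) \<in> atlas M"
  let ?d = "(A, h)" and ?F = "\<lambda>y. frechet_derivative (h \<circ> chart_inv c) (at y) b"
  have F: "smooth_on (snd c ` (fst c \<inter> fst ?d)) ?F"
    using smooth_on_frechet_derivative[OF smooth_on_transition[OF i c d]] by simp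
  have S: "open (snd ?d ` (fst ?d \<inter> fst c))" using i d c by (rule open_overlap_image)
  have "smooth_on (snd ?d ` (fst ?d \<inter> fst c)) (\<lambda>x. ?F ((snd c \<circ> chart_inv ?d) x))"
    by (rule smooth_on_compose[OF S open_overlap_image[OF i c d] _ F smooth_on_transition[OF i d c]])
      (auto simp: chart_inv_chart[OF M d, simplified])
  then have "smooth_on (snd ?d ` (fst ?d \<inter> fst c)) (\<lambda>x. coord_field M c b (chart_inv ?d x) ?d)"
    by (rule smooth_on_cong[OF S, rotated])
      (use c d in \<open>auto simp: chart_inv_chart[OF M d, simplified] coord_field_def charts_at_def\<close>)
  then show "smooth_on (snd ?d ` (fst c \<inter> fst ?d)) (\<lambda>x. coord_field M c b (chart_inv ?d x) ?d)"
    by (simp add: Int_commute)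
qed

text \<open>\<open>differential\<close> reads its argument only in \<open>chart_at M p\<close>.
  Hence its image is a tangent vector of \<open>N\<close> for every \<open>u\<close>, whereas the
  formula in an arbitrary chart \<open>c\<close> relies on \<open>u\<close> transforming
  correctly.\<close>

lemma
  assumes i: "smooth_inclusion M N" and p: "p \<in> points M"
  shows incl_diff_tangent: "incl_diff M N p u \<in> tangent_space N p"
    and incl_diff_chart: "u \<in> tangent_space M p \<Longrightarrow> c \<in> charts_at M p \<Longrightarrow> d \<in> charts_at N p \<Longrightarrow>
      incl_diff M N p u d = jac p c d (u c)"
proof -
  have M: "smooth_manifold M" "smooth_manifold N" using i by (auto simp: smooth_inclusion_def)
  note c0 = chart_at_charts_at[OF M(1) p]
  have eq: "incl_diff M N p u d = (if d \<in> charts_at N p then jac p (chart_at M p) d (u (chart_at M p)) else 0)"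
    for d by (simp add: differential_def Let_def comp_def)
  show "incl_diff M N p u \<in> tangent_space N p"
  proof (rule tangent_spaceI)
    show "incl_diff M N p u e = jac p d e (incl_diff M N p u d)"
      if "d \<in> charts_at N p" "e \<in> charts_at N p" for d e
      using jac_chain[OF i smooth_inclusion_refl[OF M(2)] c0 that, of "u (chart_at M p)"] that
      by (simp only: eq if_True)
  qed (simp add: eq)
  show "incl_diff M N p u d = jac p c d (u c)"
    if "u \<in> tangent_space M p" "c \<in> charts_at M p" "d \<in> charts_at N p"
    unfolding eq tangent_space_change_chart[OF that(1) c0 that(2)]
    using jac_chain[OF smooth_inclusion_refl[OF M(1)] i c0 that(2,3), of "u (chart_at M p)"] that(3)
    by (simp only: if_True)
qed

section \<open>Smooth fields and the metric in a chart\<close>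

lemma smooth_vfield_subset: "smooth_vfield M U X \<Longrightarrow> W \<subseteq> U \<Longrightarrow> smooth_vfield M W X"
  unfolding smooth_vfield_def by (meson Int_mono image_mono order_refl smooth_on_subset subsetD)

lemma smooth_vfield_tangent: "smooth_vfield M U X \<Longrightarrow> p \<in> U \<Longrightarrow> X p \<in> tangent_space M p"
  by (simp add: smooth_vfield_def)

lemma smooth_vfield_has_derivative:
  assumes "smooth_vfield M U X" "p \<in> U" "c \<in> charts_at M p"
  shows "((\<lambda>x. X (chart_inv c x) c) has_derivative
    frechet_derivative (\<lambda>x. X (chart_inv c x) c) (at (snd c p))) (at (snd c p))"
  using assms smooth_on_differentiable[of "snd c ` (U \<inter> fst c)" _ "snd c p"]
  by (auto simp: smooth_vfield_def charts_at_def frechet_derivative_works[symmetric])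

lemma
  assumes "riemannian_metric M g" "p \<in> points M" "u \<in> tangent_space M p" "v \<in> tangent_space M p"
  shows metric_commute: "g p u v = g p v u"
    and metric_add: "w \<in> tangent_space M p \<Longrightarrow> g p (u + w) v = g p u v + g p w v"
    and metric_scale: "g p (r *\<^sub>T u) v = r * g p u v"
  using assms by (auto simp: riemannian_metric_def)

lemma metric_diff:
  assumes M: "smooth_manifold M" "riemannian_metric M g" "p \<in> points M"
    and t: "u \<in> tangent_space M p" "v \<in> tangent_space M p" "w \<in> tangent_space M p"
  shows "g p (u - w) v = g p u v - g p w v"
  using metric_add[OF M(2,3) tangent_space_diff[OF M(1) t(1,3)] t(2,3)] by simp

text \<open>These are the metric coefficients of a chart, as a family of bilinear forms on the model
  space. Passing through \<open>coord_field\<close> makes each value a value of \<open>g\<close> on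
  tangent vectors, so that the axioms of a metric give bilinearity and smoothness directly.\<close>

definition coord_metric ::
  "('a, 'e::euclidean_space) manifold \<Rightarrow> ('a, 'e) twotensor \<Rightarrow> ('a, 'e) chart \<Rightarrow> 'e \<Rightarrow> 'e \<Rightarrow> 'e \<Rightarrow> real" where
  "coord_metric M g c y u v =
    g (chart_inv c y) (coord_field M c u (chart_inv c y)) (coord_field M c v (chart_inv c y))"

lemma coord_metric_eq:
  assumes "smooth_manifold M" "u \<in> tangent_space M p" "v \<in> tangent_space M p" "c \<in> charts_at M p"
  shows "g p u v = coord_metric M g c (snd c p) (u c) (v c)"
  using assms tangent_space_eq_coord_field[OF assms(1)]
  by (simp add: coord_metric_def chart_inv_chart charts_at_atlas charts_at_mem)

lemma bilinear_coord_metric: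
  assumes M: "smooth_manifold M" and g: "riemannian_metric M g" and c: "c \<in> atlas M"
    and y: "y \<in> snd c ` fst c"
  shows "bilinear (coord_metric M g c y)"
proof -
  define p where "p = chart_inv c y"
  have p: "p \<in> fst c" using y chart_inv_chart[OF M c] by (auto simp: p_def)
  then have c': "c \<in> charts_at M p" and pM: "p \<in> points M"
    using c chart_subset[OF M c] by (auto simp: charts_at_def)
  note t = coord_field_tangent[OF M c']
  have "linear (\<lambda>u. g p (coord_field M c u p) (coord_field M c v p))" for v
    by (rule linearI) (simp_all add: coord_field_add[OF M c'] coord_field_scale[OF M c']
        metric_add[OF g pM t t t] metric_scale[OF g pM t t])
  moreover have "g p (coord_field M c u p) (coord_field M c v p)
      = g p (coord_field M c v p) (coord_field M c u p)" for u v
    by (rule metric_commute[OF g pM t t])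
  ultimately show ?thesis
    by (simp add: bilinear_def coord_metric_def p_def[symmetric])
qed

lemma coord_metric_has_derivative:
  assumes M: "smooth_manifold M" and g: "riemannian_metric M g" and c: "c \<in> charts_at M p"
  shows "((\<lambda>y. coord_metric M g c y u v) has_derivative
    frechet_derivative (\<lambda>y. coord_metric M g c y u v) (at (snd c p))) (at (snd c p))"
proof -
  note a = charts_at_atlas[OF c]
  have "smooth_fun M (fst c) (\<lambda>p. g p (coord_field M c u p) (coord_field M c v p))"
    using openin_chart[OF M a] smooth_vfield_coord_field[OF M a]
    by (intro g[unfolded riemannian_metric_def, THEN conjunct2, rule_format]) simp
  from this[unfolded smooth_fun_def, rule_format, OF a]
  have "smooth_on (snd c ` fst c) (\<lambda>y. coord_metric M g c y u v)"
    unfolding coord_metric_def comp_def by simp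
  from smooth_on_differentiable[OF this imageI[OF charts_at_mem[OF c]]]
  show ?thesis by (simp add: frechet_derivative_works)
qed

section \<open>The Levi-Civita connection and the Lie derivative of the metric\<close>

lemma
  assumes D: "levi_civita M g D" and M: "smooth_manifold M" and U: "openin (mtop M) U"
    and X: "smooth_vfield M U X" and Y: "smooth_vfield M U Y" and p: "p \<in> U"
  shows levi_civita_tangent: "D X Y p \<in> tangent_space M p"
    and levi_civita_torsion_free: "lie_bracket M X Y p = D X Y p - D Y X p"
    and levi_civita_metric: "smooth_vfield M U Z \<Longrightarrow>
      vderiv M X (\<lambda>q. g q (Y q) (Z q)) p = g p (D X Y p) (Z p) + g p (Y p) (D X Z p)"
proof -
  have lc: "D X Y p - D Y X p = lie_bracket M X Y p \<and>
      vderiv M X (\<lambda>q. g q (Y q) (Z q)) p = g p (D X Y p) (Z p) + g p (Y p) (D X Z p)"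
    if "smooth_vfield M U Z" for Z
    using D U X Y that p unfolding levi_civita_def by blast
  have "smooth_vfield M U (D X Y)"
    using D U X Y unfolding levi_civita_def affine_connection_def by blast
  with p show "D X Y p \<in> tangent_space M p" by (simp add: smooth_vfield_def)
  show "lie_bracket M X Y p = D X Y p - D Y X p"
    using lc[OF Y] by simp
  show "vderiv M X (\<lambda>q. g q (Y q) (Z q)) p = g p (D X Y p) (Z p) + g p (Y p) (D X Z p)"
    if "smooth_vfield M U Z"
    using lc[OF that] by simp
qed

text \<open>Torsion-freeness writes the bracket as a difference of two covariant derivatives, which
  are tangent. This replaces the coordinate check that second derivatives of transition maps
  cancel.\<close>

lemma lie_bracket_tangent:
  assumes "levi_civita M g D" and M: "smooth_manifold M" and "openin (mtop M) U"
    and "smooth_vfield M U X" "smooth_vfield M U Y" and "p \<in> U"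
  shows "lie_bracket M X Y p \<in> tangent_space M p"
  unfolding levi_civita_torsion_free[OF assms]
  using assms by (intro tangent_space_diff[OF M] levi_civita_tangent[where U = U])

text \<open>Metric compatibility expands the derivative of g(Y, Z) along \<open>X\<close>, and
  torsion-freeness expands the two brackets; the covariant derivatives in the direction of
  \<open>X\<close> cancel.\<close>

lemma lie_deriv2_metric:
  assumes D: "levi_civita M g D" and M: "smooth_manifold M" "riemannian_metric M g"
    and U: "openin (mtop M) U"
    and X: "smooth_vfield M U X" and Y: "smooth_vfield M U Y" and Z: "smooth_vfield M U Z"
    and p: "p \<in> U"
  shows "lie_deriv2 M X g Y Z p = g p (D Y X p) (Z p) + g p (Y p) (D Z X p)"
proof -
  have pM: "p \<in> points M" using U p openin_subset by blast
  note t = levi_civita_tangent[OF D M(1) U _ _ p] smooth_vfield_tangent[OF _ p]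
  have "g p (Y p) (D X Z p - D Z X p) = g p (Y p) (D X Z p) - g p (Y p) (D Z X p)"
    using metric_diff[OF M pM t(1)[OF X Z] t(2)[OF Y] t(1)[OF Z X]]
      metric_commute[OF M(2) pM t(2)[OF Y]] t(1)[OF X Z] t(1)[OF Z X] tangent_space_diff[OF M(1)]
    by metis
  then show ?thesis
    unfolding lie_deriv2_def levi_civita_metric[OF D M(1) U X Y p Z]
      levi_civita_torsion_free[OF D M(1) U X Y p] levi_civita_torsion_free[OF D M(1) U X Z p]
    using metric_diff[OF M pM t(1)[OF X Y] t(2)[OF Z] t(1)[OF Y X]] by simp
qed

text \<open>Coordinate fields have constant components in their own chart, so their bracket with
  \<open>X\<close> is minus the derivative of the components of \<open>X\<close>. The resulting
  expression is the left-hand side of the assumption \<open>kill\<close> in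
  \<open>killing_pullback_coordinates\<close>. The connection serves to make the brackets
  tangent.\<close>

lemma lie_deriv2_coord_fields:
  assumes D: "levi_civita M g D" and M: "smooth_manifold M" "riemannian_metric M g"
    and p: "p \<in> points M" and X: "smooth_vfield M (points M) X"
  defines "c \<equiv> chart_at M p"
  defines "X' \<equiv> frechet_derivative (\<lambda>x. X (chart_inv c x) c) (at (snd c p))"
  shows "lie_deriv2 M X g (coord_field M c u) (coord_field M c v) p
    = frechet_derivative (\<lambda>y. coord_metric M g c y u v) (at (snd c p)) (X p c)
    + coord_metric M g c (snd c p) (X' u) v + coord_metric M g c (snd c p) u (X' v)"
proof -
  have c: "c \<in> charts_at M p" unfolding c_def by (rule chart_at_charts_at[OF M(1) p])
  note a = charts_at_atlas[OF c] and q = charts_at_mem[OF c]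
  note U = openin_chart[OF M(1) a] and E = smooth_vfield_coord_field[OF M(1) a]
  have XU: "smooth_vfield M (fst c) X"
    using X chart_subset[OF M(1) a] by (rule smooth_vfield_subset)
  have const: "frechet_derivative (\<lambda>x. coord_field M c w (chart_inv c x) c) (at (snd c p)) = (\<lambda>_. 0)" for w
  proof -
    have "((\<lambda>x. w) has_derivative (\<lambda>_. 0)) (at (snd c p))" by simp
    then have "((\<lambda>x. coord_field M c w (chart_inv c x) c) has_derivative (\<lambda>_. 0)) (at (snd c p))"
      by (rule has_derivative_transform_within_open[OF _ open_chart_image[OF M(1) a U]])
        (use q a in \<open>auto simp: chart_inv_chart[OF M(1) a] charts_at_def intro!: coord_field_self[OF M(1), symmetric]\<close>)
    from frechet_derivative_at[OF this] show ?thesis by simp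
  qed
  have br: "lie_bracket M X (coord_field M c w) p c = - X' w" for w
    by (simp add: lie_bracket_def c const X'_def coord_field_self[OF M(1) c])
  note t = lie_bracket_tangent[OF D M(1) U XU E q] coord_field_tangent[OF M(1) c]
  have bl: "bilinear (coord_metric M g c (snd c p))"
    using M a q by (intro bilinear_coord_metric) auto
  have "g p (lie_bracket M X (coord_field M c u) p) (coord_field M c v p) = - coord_metric M g c (snd c p) (X' u) v"
    "g p (coord_field M c u p) (lie_bracket M X (coord_field M c v) p) = - coord_metric M g c (snd c p) u (X' v)"
    by (simp_all add: coord_metric_eq[OF M(1) t c] coord_metric_eq[OF M(1) t(2,1) c] br
        coord_field_self[OF M(1) c] bilinear_lneg[OF bl] bilinear_rneg[OF bl])
  then show ?thesis
    by (simp add: lie_deriv2_def vderiv_def Let_def c_def[symmetric] coord_metric_def[abs_def] comp_def)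
qed

section \<open>Restricting a Killing field to a submanifold\<close>

lemma restrict_vfield:
  assumes "tangent_to M N X" "p \<in> points M"
  shows "restrict_vfield M N X p \<in> tangent_space M p"
    and "incl_diff M N p (restrict_vfield M N X p) = X p"
proof -
  have "X p \<in> incl_diff M N p ` tangent_space M p" using assms by (simp add: tangent_to_def)
  then show "restrict_vfield M N X p \<in> tangent_space M p"
    "incl_diff M N p (restrict_vfield M N X p) = X p"
    unfolding restrict_vfield_def by (rule inv_into_into, rule f_inv_into_f)
qed

text \<open>Every vector of the model space is the component of a coordinate field at
  \<open>p\<close>, so injectivity of the differential on the tangent space carries over to the
  Jacobian.\<close>

lemma inj_jac_submanifold:
  assumes M: "submanifold M N" and c: "c \<in> charts_at M p" and d: "d \<in> charts_at N p"
  shows "inj (jac p c d)"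
proof (rule injI)
  fix u v assume eq: "jac p c d u = jac p c d v"
  have i: "smooth_inclusion M N" and sM: "smooth_manifold M"
    using M by (auto intro: submanifold_smooth_inclusion simp: submanifold_def)
  have p: "p \<in> points M"
    using chart_subset[OF sM charts_at_atlas[OF c]] charts_at_mem[OF c] by blast
  note t = coord_field_tangent[OF sM c]
  have "incl_diff M N p (coord_field M c u p) = incl_diff M N p (coord_field M c v p)"
    using eq by (intro tangent_space_eqI[OF incl_diff_tangent[OF i p] incl_diff_tangent[OF i p] d])
      (simp add: incl_diff_chart[OF i p t c d] coord_field_self[OF sM c])
  moreover have "inj_on (incl_diff M N p) (tangent_space M p)"
    using M p by (simp add: submanifold_def)
  ultimately have "coord_field M c u p = coord_field M c v p"
    using t by (meson inj_onD)
  then show "u = v" by (metis coord_field_self[OF sM c])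
qed

lemma lie_deriv2_induced_metric_eq_0:
  assumes MN: "submanifold M N" and g: "riemannian_metric N g" and DN: "levi_civita N g DN"
    and X: "smooth_vfield N (points N) X" and tan: "tangent_to M N X"
    and kill: "\<And>U Y Z p. openin (mtop N) U \<Longrightarrow> smooth_vfield N U Y \<Longrightarrow> smooth_vfield N U Z \<Longrightarrow> p \<in> U \<Longrightarrow>
      lie_deriv2 N X g Y Z p = 0"
    and U: "openin (mtop M) U" and Y: "smooth_vfield M U Y" and Z: "smooth_vfield M U Z" and p: "p \<in> U"
  shows "lie_deriv2 M (restrict_vfield M N X) (induced_metric M N g) Y Z p = 0"
proof -
  define V where "V = restrict_vfield M N X"
  have i: "smooth_inclusion M N" and sM: "smooth_manifold M" and sN: "smooth_manifold N"
    and sub: "points M \<subseteq> points N"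
    using MN by (auto intro: submanifold_smooth_inclusion simp: submanifold_def)
  have UM: "U \<subseteq> points M" using U by (rule openin_subset)
  have pM: "p \<in> points M" and pN: "p \<in> points N" using p UM sub by auto
  \<comment> \<open>The charts are the ones selected by \<open>chart_at\<close>:
    \<open>vderiv\<close> and \<open>differential\<close> on \<open>M\<close> evaluate in
    \<open>c\<close>, and the coordinate form of the Killing equation on \<open>N\<close> is
    available in \<open>d\<close>.\<close>
  define c where "c = chart_at M p"
  define d where "d = chart_at N p"
  have c: "c \<in> charts_at M p" and d: "d \<in> charts_at N p"
    unfolding c_def d_def by (rule chart_at_charts_at[OF sM pM], rule chart_at_charts_at[OF sN pN])
  note ca = charts_at_atlas[OF c] charts_at_mem[OF c] and da = charts_at_atlas[OF d] charts_at_mem[OF d]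
  define f where "f = snd d \<circ> chart_inv c"
  define S where "S = snd c ` (U \<inter> (fst c \<inter> fst d))"
  have S: "open S" "snd c p \<in> S"
    unfolding S_def using openin_Int[OF U openin_overlap[OF i ca(1) da(1)]] p ca(2) da(2)
    by (auto intro!: open_chart_image[OF sM ca(1)])
  have f: "smooth_on S f"
    unfolding f_def S_def using smooth_on_transition[OF i ca(1) da(1)] by (rule smooth_on_subset) auto
  have fp: "f (snd c p) = snd d p" by (simp add: f_def chart_inv_chart[OF sM ca])
  have S_mem: "chart_inv c x \<in> U" "c \<in> charts_at M (chart_inv c x)" "d \<in> charts_at N (chart_inv c x)"
      "snd c (chart_inv c x) = x" "snd d (chart_inv c x) = f x" if "x \<in> S" for x
    using that ca(1) da(1) by (auto simp: S_def f_def charts_at_def chart_inv_chart[OF sM ca(1)])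
  let ?B = "coord_metric N g d"
  have metric: "induced_metric M N g q u v = ?B (snd d q) (jac q c d (u c)) (jac q c d (v c))"
    if "q \<in> points M" "u \<in> tangent_space M q" "v \<in> tangent_space M q" "c \<in> charts_at M q" "d \<in> charts_at N q"
    for q u v
    unfolding induced_metric_def
    using that by (simp add: coord_metric_eq[OF sN incl_diff_tangent[OF i] incl_diff_tangent[OF i]]
        incl_diff_chart[OF i])
  have Vt: "V q \<in> tangent_space M q" "incl_diff M N q (V q) = X q" if "q \<in> points M" for q
    using restrict_vfield[OF tan that] by (auto simp: V_def)
  let ?co = "\<lambda>W x. W (chart_inv c x) c" and ?X = "\<lambda>y. X (chart_inv d y) d"
  have rel: "frechet_derivative f (at x) (?co V x) = ?X (f x)" if "x \<in> S" for x
  proof -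
    note m = S_mem[OF that]
    have q: "chart_inv c x \<in> points M" using m(1) UM by auto
    have "chart_inv d (f x) = chart_inv c x"
      unfolding m(5)[symmetric] using m(3) by (intro chart_inv_chart[OF sN]) (auto simp: charts_at_def)
    then show ?thesis
      using incl_diff_chart[OF i q Vt(1)[OF q] m(2,3)] by (simp add: Vt(2)[OF q] f_def m(4))
  qed
  have X': "(?X has_derivative frechet_derivative ?X (at (f (snd c p)))) (at (f (snd c p)))"
    using smooth_vfield_has_derivative[OF X pN d] by (simp add: fp)
  \<comment> \<open>\<open>V\<close> comes from a pointwise choice of preimages. By
    \<open>rel\<close> its components solve a linear equation with the Jacobian of the inclusion as
    coefficients, and the immersion property makes that Jacobian injective.\<close>
  have "?co V differentiable at (snd c p)"
  proof (rule differentiable_solution_linear_equation[OF S])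
    show "linear (frechet_derivative f (at x))" if "x \<in> S" for x
      using smooth_on_differentiable[OF f that] by (rule linear_frechet_derivative)
    show "(\<lambda>x. frechet_derivative f (at x) u) differentiable at (snd c p)" for u
      using smooth_on_frechet_derivative[OF f] S(2) by (rule smooth_on_differentiable)
    show "inj (frechet_derivative f (at (snd c p)))"
      unfolding f_def by (rule inj_jac_submanifold[OF MN c d])
    show "(\<lambda>x. ?X (f x)) differentiable at (snd c p)"
      using has_derivative_compose[OF smooth_on_differentiable[OF f S(2), unfolded frechet_derivative_works] X']
      unfolding differentiable_def by blast
  qed (rule rel)
  then have V': "(?co V has_derivative frechet_derivative (?co V) (at (snd c p))) (at (snd c p))"
    by (simp add: frechet_derivative_works)
  note Y' = smooth_vfield_has_derivative[OF Y p c] and Z' = smooth_vfield_has_derivative[OF Z p c]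
  have bil: "\<forall>\<^sub>F y in nhds (f (snd c p)). bilinear (?B y)"
    unfolding fp
    using eventually_nhds_in_open[OF open_chart_image[OF sN da(1) openin_chart[OF sN da(1)] order_refl]
        imageI[OF da(2)]]
    by eventually_elim (rule bilinear_coord_metric[OF sN g da(1)])
  \<comment> \<open>The Killing hypothesis on \<open>N\<close> is used for the coordinate fields of
    \<open>d\<close> alone, on the domain of \<open>d\<close>.\<close>
  have killc: "frechet_derivative (\<lambda>y. ?B y u v) (at (f (snd c p))) (?X (f (snd c p)))
      + ?B (f (snd c p)) (frechet_derivative ?X (at (f (snd c p))) u) v
      + ?B (f (snd c p)) u (frechet_derivative ?X (at (f (snd c p))) v) = 0" for u v
    using lie_deriv2_coord_fields[OF DN sN g pN X, of u v]
      kill[OF openin_chart[OF sN da(1)] smooth_vfield_coord_field[OF sN da(1)]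
        smooth_vfield_coord_field[OF sN da(1)] da(2), of u v]
    by (simp add: d_def[symmetric] fp chart_inv_chart[OF sN da])
  have B': "((\<lambda>y. ?B y u v) has_derivative frechet_derivative (\<lambda>y. ?B y u v) (at (f (snd c p))))
      (at (f (snd c p)))" for u v
    unfolding fp by (rule coord_metric_has_derivative[OF sN g d])
  let ?D = "\<lambda>W. frechet_derivative (?co W) (at (snd c p))"
  let ?G = "\<lambda>x. ?B (f x) (frechet_derivative f (at x) (?co Y x)) (frechet_derivative f (at x) (?co Z x))"
  have main: "frechet_derivative ?G (at (snd c p)) (?co V (snd c p))
      = ?B (f (snd c p)) (frechet_derivative f (at (snd c p)) (?D Y (?co V (snd c p)) - ?D V (?co Y (snd c p))))
          (frechet_derivative f (at (snd c p)) (?co Z (snd c p)))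
      + ?B (f (snd c p)) (frechet_derivative f (at (snd c p)) (?co Y (snd c p)))
          (frechet_derivative f (at (snd c p)) (?D Z (?co V (snd c p)) - ?D V (?co Z (snd c p))))"
    by (rule killing_pullback_coordinates[where B = ?B
          and B' = "\<lambda>u v. frechet_derivative (\<lambda>y. ?B y u v) (at (f (snd c p)))"
          and X = ?X and X' = "frechet_derivative ?X (at (f (snd c p)))"
          and V = "?co V" and Y = "?co Y" and Z = "?co Z"
          and V' = "?D V" and Y' = "?D Y" and Z' = "?D Z",
          OF S f bil B' X' killc V' rel Y' Z'])
  have G_eq: "?G x = induced_metric M N g (chart_inv c x) (Y (chart_inv c x)) (Z (chart_inv c x))" if "x \<in> S" for x
    using S_mem[OF that] UM smooth_vfield_tangent[OF Y] smooth_vfield_tangent[OF Z]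
    by (subst metric) (auto simp: f_def[symmetric])
  \<comment> \<open>Differentiability of \<open>?G\<close> is what allows its derivative to be
    transferred to the function inside \<open>vderiv\<close>, which agrees with \<open>?G\<close> on
    \<open>S\<close>.\<close>
  have "?G differentiable at (snd c p)"
    using has_derivative_bilinear_family[where B = ?B
        and B' = "\<lambda>u v. frechet_derivative (\<lambda>y. ?B y u v) (at (f (snd c p)))", OF bil B'
        smooth_on_differentiable[OF f S(2), unfolded frechet_derivative_works]
        has_derivative_frechet_derivative_apply[OF S f Y'] has_derivative_frechet_derivative_apply[OF S f Z']]
    unfolding differentiable_def by blast
  from frechet_derivative_transform_within_open[OF this S G_eq]
  have vd: "vderiv M V (\<lambda>q. induced_metric M N g q (Y q) (Z q)) p
      = frechet_derivative ?G (at (snd c p)) (?co V (snd c p))"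
    by (simp add: vderiv_def Let_def c_def[symmetric] comp_def chart_inv_chart[OF sM ca])
  \<comment> \<open>Since \<open>c\<close> is the chart used by \<open>differential\<close>, this
    holds for every \<open>u\<close>, tangent or not. The formulas therefore apply to the brackets
    with \<open>V\<close>; \<open>lie_bracket_tangent\<close> would ask for smoothness of
    \<open>V\<close>, of which only differentiability at the point has been established.\<close>
  have incl_d: "incl_diff M N p u d = jac p c d (u c)" for u
    using d by (simp add: differential_def Let_def c_def[symmetric] comp_def)
  have ind: "induced_metric M N g p u v = ?B (snd d p) (jac p c d (u c)) (jac p c d (v c))" for u v
    unfolding induced_metric_def incl_d[symmetric]
    by (rule coord_metric_eq[OF sN incl_diff_tangent[OF i pM] incl_diff_tangent[OF i pM] d])
  have br: "induced_metric M N g p (lie_bracket M V W p) w = ?B (snd d p)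
      (jac p c d (frechet_derivative (?co W) (at (snd c p)) (V p c) - frechet_derivative (?co V) (at (snd c p)) (W p c)))
      (jac p c d (w c))"
    "induced_metric M N g p w (lie_bracket M V W p) = ?B (snd d p) (jac p c d (w c))
      (jac p c d (frechet_derivative (?co W) (at (snd c p)) (V p c) - frechet_derivative (?co V) (at (snd c p)) (W p c)))"
    for W w
    unfolding ind by (simp_all add: lie_bracket_def c)
  show ?thesis
    using main unfolding lie_deriv2_def V_def[symmetric] vd br
    by (simp add: fp f_def[symmetric] chart_inv_chart[OF sM ca])
qed

section \<open>The structure field is Killing, and the soliton equation\<close>

lemma sq_sasakian_lie_deriv2:
  assumes sq: "sq_sasakian M \<phi> \<xi> \<eta> g" and U: "openin (mtop M) U"
    and Y: "smooth_vfield M U Y" and Z: "smooth_vfield M U Z" and p: "p \<in> U"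
  shows "lie_deriv2 M \<xi> g Y Z p = 0"
proof -
  have ac: "almost_contact_metric M \<phi> \<xi> \<eta> g" using sq by (simp add: sq_sasakian_def)
  then have M: "smooth_manifold M" "riemannian_metric M g" and X: "smooth_vfield M (points M) \<xi>"
    and phi: "tensor_1_1 M \<phi>"
    by (auto simp: almost_contact_metric_def)
  obtain D \<beta> where D: "levi_civita M g D"
    and xi: "\<And>X. smooth_vfield M U X \<Longrightarrow> D X \<xi> p = (- \<beta> p) *\<^sub>T \<phi> p (X p)"
    using sq U p unfolding sq_sasakian_def by metis
  have pM: "p \<in> points M" and UM: "U \<subseteq> points M" using U p openin_subset by blast+
  note t = smooth_vfield_tangent[OF Y p] smooth_vfield_tangent[OF Z p]
  have ft: "\<phi> p u \<in> tangent_space M p" if "u \<in> tangent_space M p" for u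
    using phi pM that by (simp add: tensor_1_1_def)
  have skew: "g p (\<phi> p (Y p)) (Z p) = - g p (Y p) (\<phi> p (Z p))"
    using ac pM t by (simp add: almost_contact_metric_def)
  have "g p (Y p) ((- \<beta> p) *\<^sub>T \<phi> p (Z p)) = - \<beta> p * g p (Y p) (\<phi> p (Z p))"
    using metric_scale[OF M(2) pM ft[OF t(2)] t(1)] metric_commute[OF M(2) pM t(1)]
      ft[OF t(2)] tangent_space_scale[OF M(1) ft[OF t(2)]] by metis
  then show ?thesis
    using lie_deriv2_metric[OF D M U smooth_vfield_subset[OF X UM] Y Z p]
      metric_scale[OF M(2) pM ft[OF t(1)] t(2)] skew
    by (simp add: xi[OF Y] xi[OF Z])
qed

theorem theorem5p1:
  fixes Mstar :: "('a, 'e::euclidean_space) manifold"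
    and M :: "('a, 'f::euclidean_space) manifold"
    and \<phi> :: "('a, 'e) endofield" and \<xi> :: "('a, 'e) vfield"
    and \<eta> :: "('a, 'e) oneform" and gstar :: "('a, 'e) twotensor"
    and g :: "('a, 'f) twotensor" and D :: "('a, 'f) connection"
    and lam :: real and m n :: nat
  assumes "DIM('e) = 2 * n + 1" and "2 * n + 1 > 3"
    and "DIM('f) = 2 * m + 1" and "m < n"
    and "sq_sasakian Mstar \<phi> \<xi> \<eta> gstar"
    and "submanifold M Mstar"
    and "g = induced_metric M Mstar gstar"
    and "anti_invariant M Mstar \<phi> gstar"
    and "tangent_to M Mstar \<xi>"
    and "levi_civita M g D"
    and "ricci_soliton M g D (restrict_vfield M Mstar \<xi>) lam"
  shows "einstein M g D"
proof -
  have R: "riemannian_metric Mstar gstar" and X: "smooth_vfield Mstar (points Mstar) \<xi>"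
    using assms(5) by (auto simp: sq_sasakian_def almost_contact_metric_def)
  \<comment> \<open>This connection is handed to \<open>lie_deriv2_induced_metric_eq_0\<close>,
    where its torsion-freeness makes ambient brackets with coordinate fields tangent.\<close>
  obtain Dstar where Ds: "levi_civita Mstar gstar Dstar"
    using assms(5) by (auto simp: sq_sasakian_def)
  have kill: "lie_deriv2 M (restrict_vfield M Mstar \<xi>) g Y Z p = 0"
    if "openin (mtop M) U" "smooth_vfield M U Y" "smooth_vfield M U Z" "p \<in> U" for U Y Z p
    unfolding assms(7)
    using assms(6) R Ds X assms(9) sq_sasakian_lie_deriv2[OF assms(5)] that
    by (rule lie_deriv2_induced_metric_eq_0)
  show ?thesis
    unfolding einstein_def
  proof (intro exI[of _ "- lam"] allI impI ballI)
    fix U Y Z p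
    assume *: "openin (mtop M) U \<and> smooth_vfield M U Y \<and> smooth_vfield M U Z" and p: "p \<in> U"
    then have "lie_deriv2 M (restrict_vfield M Mstar \<xi>) g Y Z p + 2 * ricci M D Y Z p
        + 2 * lam * g p (Y p) (Z p) = 0"
      using assms(11) unfolding ricci_soliton_def by metis
    with kill[of U Y Z p] * p show "ricci M D Y Z p = - lam * g p (Y p) (Z p)" by simp
  qed
qed

end
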